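(* (1) $2\mathrm{N}/\mathrm{poly}=\mathrm{co}\mbox{-}2\mathrm{N}/\mathrm{poly}$. (2) $2\mathrm{NPD}/\mathrm{poly}=\mathrm{co}\mbox{-}2\mathrm{NPD}/\mathrm{poly}$. Statement (2) still holds if the underlying 2npda's are required to run in polynomial time.
   Context: A promise problem over $\Sigma$ is $(A,R)$ with $A,R\subseteq\Sigma^*$, $A\cap R=\varnothing$; families are $\mathcal{L}=\{(L_n^{(+)},L_n^{(-)})\}_{n\in\mathbb{N}}$ over a common alphabet. A 2nfa is a two-way nondeterministic finite automaton (finite state set $Q$, input between endmarkers $\rhd,\lhd$, two-way read-only head); a 2npda additionally has a stack with alphabet $\Gamma$. A machine solves $(A,R)$ if every $x\in A$ has an accepting computation path and for every $x\in R$ all (halting) computation paths are rejecting. Size: $|Q|$ for 2nfa's, $|Q|\cdot|\Gamma^{\le e}|$ for 2npda's ($e$ maximal push length); polynomial size means size$(M_n)\le p(n)$ for a polynomial $p$. $2\mathrm{N}$ ($2\mathrm{NPD}$) is the class of families such that a polynomial-size family of 2nfa's (2npda's) $\{M_n\}$ has $M_n$ solving $(L_n^{(+)},L_n^{(-)})$ for all $n$; the polynomial-time version additionally requires a polynomial $p$ such that $M_n$ solves it within $p(n,|x|)$ steps. $\mathrm{co}\mbox{-}\mathcal{C}$ is the set of families $\{(L_n^{(-)},L_n^{(+)})\}_n$ with $\{(L_n^{(+)},L_n^{(-)})\}_n\in\mathcal{C}$. $\mathcal{C}/\mathrm{poly}$ is the set of families in $\mathcal{C}$ with a polynomial ceiling: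 a polynomial $p$ with $L_n^{(+)}\cup L_n^{(-)}\subseteq\Sigma^{\le p(n)}$ for all $n$. *)

theory Defs
  imports Main "HOL-Computational_Algebra.Polynomial"
begin

section \<open>Families of promise problems\<close>

text \<open>The common finite alphabet of a family is the type \<open>'a::finite\<close>.\<close>

type_synonym 'a problem = "'a list set \<times> 'a list set"
type_synonym 'a family = "nat \<Rightarrow> 'a problem"

definition promise_problem :: "'a problem \<Rightarrow> bool" where
  "promise_problem P \<longleftrightarrow> fst P \<inter> snd P = {}"

definition co :: "'a family set \<Rightarrow> 'a family set" where
  "co C = {\<lambda>n. (snd (L n), fst (L n)) | L. L \<in> C}"

definition polynomial_ceiling :: "'a family \<Rightarrow> bool" where
  "polynomial_ceiling L \<longleftrightarrow>
     (\<exists>p::nat poly. \<forall>n. \<forall>x \<in> fst (L n) \<union> snd (L n). length x \<le> poly p n)"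

definition over_poly :: "'a family set \<Rightarrow> 'a family set" where
  "over_poly C = {L \<in> C. polynomial_ceiling L}"


section \<open>Computation paths\<close>

datatype 'a tape_symbol = Left_End | Sym 'a | Right_End

definition tape :: "'a list \<Rightarrow> 'a tape_symbol list" where
  "tape x = Left_End # map Sym x @ [Right_End]"

text \<open>\<open>step\<close> is the one-step relation on configurations, \<open>acc\<close> singles out the configurations
  in an accepting state, and \<open>c\<^sub>0\<close> is the initial configuration. A path halts when its last
  configuration has no successor; so a path that gets stuck outside the halting states counts
  as a rejecting one. Infinite paths are neither accepting nor rejecting.\<close>

definition halted :: "('c \<Rightarrow> 'c \<Rightarrow> bool) \<Rightarrow> 'c \<Rightarrow> bool" where
  "halted step c \<longleftrightarrow> (\<nexists>c'. step c c')"

definition some_path_accepts :: "('c \<Rightarrow> 'c \<Rightarrow> bool) \<Rightarrow> ('c \<Rightarrow> bool) \<Rightarrow> 'c \<Rightarrow> bool" where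
  "some_path_accepts step acc c\<^sub>0 \<longleftrightarrow> (\<exists>c. step\<^sup>*\<^sup>* c\<^sub>0 c \<and> halted step c \<and> acc c)"

definition all_halting_paths_reject :: "('c \<Rightarrow> 'c \<Rightarrow> bool) \<Rightarrow> ('c \<Rightarrow> bool) \<Rightarrow> 'c \<Rightarrow> bool" where
  "all_halting_paths_reject step acc c\<^sub>0 \<longleftrightarrow> (\<forall>c. step\<^sup>*\<^sup>* c\<^sub>0 c \<and> halted step c \<longrightarrow> \<not> acc c)"

definition all_paths_within :: "('c \<Rightarrow> 'c \<Rightarrow> bool) \<Rightarrow> 'c \<Rightarrow> nat \<Rightarrow> bool" where
  "all_paths_within step c\<^sub>0 t \<longleftrightarrow> (\<forall>k c. (step ^^ k) c\<^sub>0 c \<longrightarrow> k \<le> t)"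


section \<open>Two-way nondeterministic finite automata\<close>

record ('s, 'a) nfa2 =
  nfa_states :: "'s set"
  nfa_delta :: "'s \<Rightarrow> 'a tape_symbol \<Rightarrow> ('s \<times> int) set"
  nfa_init :: 's
  nfa_acc :: "'s set"
  nfa_rej :: "'s set"

definition nfa_halting :: "('s, 'a) nfa2 \<Rightarrow> 's set" where
  "nfa_halting M = nfa_acc M \<union> nfa_rej M"

definition allowed_moves :: "'a tape_symbol \<Rightarrow> int set" where
  "allowed_moves \<sigma> = (case \<sigma> of Left_End \<Rightarrow> {0, 1} | Sym _ \<Rightarrow> {-1, 0, 1} | Right_End \<Rightarrow> {-1, 0})"

text \<open>\<open>nfa_delta\<close> is only ever consulted at non-halting states; its values at halting states
  are irrelevant.\<close>

definition nfa_wf :: "('s, 'a) nfa2 \<Rightarrow> bool" where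
  "nfa_wf M \<longleftrightarrow>
     finite (nfa_states M) \<and> nfa_init M \<in> nfa_states M \<and>
     nfa_acc M \<subseteq> nfa_states M \<and> nfa_rej M \<subseteq> nfa_states M \<and> nfa_acc M \<inter> nfa_rej M = {} \<and>
     (\<forall>q \<in> nfa_states M - nfa_halting M. \<forall>\<sigma>. nfa_delta M q \<sigma> \<subseteq> nfa_states M \<times> allowed_moves \<sigma>)"

type_synonym 's nfa_config = "'s \<times> nat"

inductive nfa_step :: "('s, 'a) nfa2 \<Rightarrow> 'a list \<Rightarrow> 's nfa_config \<Rightarrow> 's nfa_config \<Rightarrow> bool"
  for M :: "('s, 'a) nfa2" and x :: "'a list" where
  "q \<notin> nfa_halting M \<Longrightarrow> (p, d) \<in> nfa_delta M q (tape x ! i) \<Longrightarrow> int j = int i + d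
     \<Longrightarrow> nfa_step M x (q, i) (p, j)"

definition nfa_initial :: "('s, 'a) nfa2 \<Rightarrow> 's nfa_config" where
  "nfa_initial M = (nfa_init M, 0)"

definition nfa_accepting :: "('s, 'a) nfa2 \<Rightarrow> 's nfa_config \<Rightarrow> bool" where
  "nfa_accepting M c \<longleftrightarrow> fst c \<in> nfa_acc M"

definition nfa_solves :: "('s, 'a) nfa2 \<Rightarrow> 'a problem \<Rightarrow> bool" where
  "nfa_solves M P \<longleftrightarrow>
     (\<forall>x \<in> fst P. some_path_accepts (nfa_step M x) (nfa_accepting M) (nfa_initial M)) \<and>
     (\<forall>x \<in> snd P. all_halting_paths_reject (nfa_step M x) (nfa_accepting M) (nfa_initial M))"

definition nfa_size :: "('s, 'a) nfa2 \<Rightarrow> nat" where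
  "nfa_size M = card (nfa_states M)"


section \<open>Two-way nondeterministic pushdown automata\<close>

record ('s, 'g, 'a) npda2 =
  pda_states :: "'s set"
  pda_stack :: "'g set"
  pda_delta :: "'s \<Rightarrow> 'a tape_symbol \<Rightarrow> 'g \<Rightarrow> ('s \<times> 'g list \<times> int) set"
  pda_init :: 's
  pda_bottom :: 'g
  pda_acc :: "'s set"
  pda_rej :: "'s set"

definition pda_halting :: "('s, 'g, 'a) npda2 \<Rightarrow> 's set" where
  "pda_halting M = pda_acc M \<union> pda_rej M"

text \<open>The strings that may replace the topmost stack symbol \<open>\<gamma>\<close>; the head of a list is the top of
  the stack. The bottom marker stays at the bottom of the stack, and only there.\<close>

definition allowed_pushes :: "('s, 'g, 'a) npda2 \<Rightarrow> 'g \<Rightarrow> 'g list set" where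
  "allowed_pushes M \<gamma> =
     (let W = lists (pda_stack M - {pda_bottom M})
      in if \<gamma> = pda_bottom M then {w @ [pda_bottom M] | w. w \<in> W} else W)"

definition pda_wf :: "('s, 'g, 'a) npda2 \<Rightarrow> bool" where
  "pda_wf M \<longleftrightarrow>
     finite (pda_states M) \<and> finite (pda_stack M) \<and>
     pda_init M \<in> pda_states M \<and> pda_bottom M \<in> pda_stack M \<and>
     pda_acc M \<subseteq> pda_states M \<and> pda_rej M \<subseteq> pda_states M \<and> pda_acc M \<inter> pda_rej M = {} \<and>
     (\<forall>q \<in> pda_states M - pda_halting M. \<forall>\<sigma>. \<forall>\<gamma> \<in> pda_stack M.
        finite (pda_delta M q \<sigma> \<gamma>) \<and>
        pda_delta M q \<sigma> \<gamma> \<subseteq> pda_states M \<times> allowed_pushes M \<gamma> \<times> allowed_moves \<sigma>)"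

text \<open>A configuration consists of the state, the head position and the stack content.\<close>

type_synonym ('s, 'g) pda_config = "'s \<times> nat \<times> 'g list"

inductive pda_step ::
  "('s, 'g, 'a) npda2 \<Rightarrow> 'a list \<Rightarrow> ('s, 'g) pda_config \<Rightarrow> ('s, 'g) pda_config \<Rightarrow> bool"
  for M :: "('s, 'g, 'a) npda2" and x :: "'a list" where
  "q \<notin> pda_halting M \<Longrightarrow> (p, w, d) \<in> pda_delta M q (tape x ! i) \<gamma> \<Longrightarrow> int j = int i + d
     \<Longrightarrow> pda_step M x (q, i, \<gamma> # s) (p, j, w @ s)"

definition pda_initial :: "('s, 'g, 'a) npda2 \<Rightarrow> ('s, 'g) pda_config" where
  "pda_initial M = (pda_init M, 0, [pda_bottom M])"

definition pda_accepting :: "('s, 'g, 'a) npda2 \<Rightarrow> ('s, 'g) pda_config \<Rightarrow> bool" where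
  "pda_accepting M c \<longleftrightarrow> fst c \<in> pda_acc M"

definition pda_solves :: "('s, 'g, 'a) npda2 \<Rightarrow> 'a problem \<Rightarrow> bool" where
  "pda_solves M P \<longleftrightarrow>
     (\<forall>x \<in> fst P. some_path_accepts (pda_step M x) (pda_accepting M) (pda_initial M)) \<and>
     (\<forall>x \<in> snd P. all_halting_paths_reject (pda_step M x) (pda_accepting M) (pda_initial M))"

text \<open>The time bound \<open>t\<close> is a function of the input length and concerns all computation paths on
  promised inputs.\<close>

definition pda_solves_within :: "('s, 'g, 'a) npda2 \<Rightarrow> 'a problem \<Rightarrow> (nat \<Rightarrow> nat) \<Rightarrow> bool" where
  "pda_solves_within M P t \<longleftrightarrow> pda_solves M P \<and>
     (\<forall>x \<in> fst P \<union> snd P. all_paths_within (pda_step M x) (pda_initial M) (t (length x)))"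

definition pushed_strings :: "('s, 'g, 'a) npda2 \<Rightarrow> 'g list set" where
  "pushed_strings M = {w. \<exists>q \<in> pda_states M - pda_halting M. \<exists>\<sigma>. \<exists>\<gamma> \<in> pda_stack M. \<exists>p d.
     (p, w, d) \<in> pda_delta M q \<sigma> \<gamma>}"

text \<open>The maximal push length, and \<open>0\<close> for a machine without transitions.\<close>

definition push_size :: "('s, 'g, 'a) npda2 \<Rightarrow> nat" where
  "push_size M = Max (insert 0 (length ` pushed_strings M))"

definition pda_size :: "('s, 'g, 'a) npda2 \<Rightarrow> nat" where
  "pda_size M =
     card (pda_states M) * card {w \<in> lists (pda_stack M). length w \<le> push_size M}"


section \<open>Nonuniform complexity classes\<close>

text \<open>Up to renaming, all states and stack symbols are natural numbers.\<close>

definition two_N :: "'a::finite family set" where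
  "two_N = {L. (\<forall>n. promise_problem (L n)) \<and>
     (\<exists>(M :: nat \<Rightarrow> (nat, 'a) nfa2) (p :: nat poly).
        \<forall>n. nfa_wf (M n) \<and> nfa_size (M n) \<le> poly p n \<and> nfa_solves (M n) (L n))}"

definition two_NPD :: "'a::finite family set" where
  "two_NPD = {L. (\<forall>n. promise_problem (L n)) \<and>
     (\<exists>(M :: nat \<Rightarrow> (nat, nat, 'a) npda2) (p :: nat poly).
        \<forall>n. pda_wf (M n) \<and> pda_size (M n) \<le> poly p n \<and> pda_solves (M n) (L n))}"

text \<open>A polynomial \<open>t(n, m)\<close> in two variables is a polynomial in \<open>m\<close> whose coefficients are
  polynomials in \<open>n\<close>.\<close>

definition poly2 :: "nat poly poly \<Rightarrow> nat \<Rightarrow> nat \<Rightarrow> nat" where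
  "poly2 t n m = poly (poly t [:m:]) n"

definition two_NPD_ptime :: "'a::finite family set" where
  "two_NPD_ptime = {L. (\<forall>n. promise_problem (L n)) \<and>
     (\<exists>(M :: nat \<Rightarrow> (nat, nat, 'a) npda2) (p :: nat poly) (t :: nat poly poly).
        \<forall>n. pda_wf (M n) \<and> pda_size (M n) \<le> poly p n \<and>
            pda_solves_within (M n) (L n) (poly2 t n))}"

end

theory Submission
  imports Defs "HOL-Library.Countable"
begin

text \<open>On inputs of polynomial length both kinds of automata are captured by derivation systems with
  polynomially many items and rules that have at most two premises and depend on one tape symbol.
  For a 2nfa the items are the configurations and every rule has at most one premise; for a 2npda
  they express that a short word is popped between two given surface configurations. Inductive
  counting over the levels of a system (Immerman, Szelepcsenyi) gives a system of polynomial size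
  for underivability: knowing the size of a level, one refutes membership in the next one by
  exhibiting all members of the level. Conversely, a 2npda searches for a derivation
  depth-first, keeping the open goals on its stack. Without time bounds nothing else is needed.
  For linear systems the counting system only needs stacks of height 4, which fit into the states
  of a 2nfa. If each item carries a budget that bounds the size of its derivations, the derivations in the counting system are of polynomial
  size, and a clock in the states stops all other computation paths.\<close>


section \<open>Derivation systems\<close>

text \<open>Counting needs a polynomially large set to count, but the stack contents of a 2npda are
  unbounded and its shortest accepting paths may be exponentially long. Hence items, not
  configurations, are counted. Items contain head positions, and this is where the polynomial
  ceiling is indispensable: it makes their number polynomial in \<open>n\<close>. The price is that
  membership in a level is itself recursive, so the complement system must again be able to solve
  goals with two premises. What counting adds always has the shape of a side goal followed by a
  continuation, so complementing stays inside the same class of systems. Wrong counter values need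
  no treatment: starting from the empty level, only the correct choice at each item has a derivable
  side goal. The timed case needs budgets because depth-first search traverses a derivation as a
  tree, without sharing. An item in a low level may still have only exponentially large trees,
  whereas a short computation path always provides a small one.\<close>

definition sym_at :: "'a list \<Rightarrow> nat \<Rightarrow> 'a tape_symbol" where
  "sym_at x i = (if i \<le> length x then tape x ! i else Right_End)"

record ('i, 'a) dsys =
  ds_items :: "'i set"
  ds_pos :: "'i \<Rightarrow> nat"
  ds_rules :: "'i \<Rightarrow> 'a tape_symbol \<Rightarrow> 'i list set"
  ds_root :: 'i

text \<open>The limit of 2 premises keeps the pushes of the resulting 2npda at length 2, so that the
  stack factor of its size is quadratic. It also makes the number of candidate premise lists scanned
  by \<open>Refute\<close> quadratic.\<close>

definition ds_wf :: "nat \<Rightarrow> ('i, 'a) dsys \<Rightarrow> bool" where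
  "ds_wf B D \<longleftrightarrow> finite (ds_items D) \<and> ds_root D \<in> ds_items D \<and>
     (\<forall>a \<in> ds_items D. ds_pos D a \<le> B \<and>
       (\<forall>\<sigma>. \<forall>L \<in> ds_rules D a \<sigma>. set L \<subseteq> ds_items D \<and> length L \<le> 2))"

abbreviation active :: "('i, 'a) dsys \<Rightarrow> 'a list \<Rightarrow> 'i \<Rightarrow> 'i list set" where
  "active D x a \<equiv> ds_rules D a (sym_at x (ds_pos D a))"

text \<open>Depth-first search is made explicit as a stack discipline because height and number of
  rule applications are the resources that the machines must bound. The height is tested only after
  a replacement, so the initial stack may exceed \<open>h\<close>, and later lemmas treat its length
  separately.\<close>

inductive run :: "('i, 'a) dsys \<Rightarrow> 'a list \<Rightarrow> nat \<Rightarrow> nat \<Rightarrow> 'i list \<Rightarrow> bool"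
  for D x h where
  run_Nil: "run D x h k []"
| run_Cons: "L \<in> active D x a \<Longrightarrow> length (L @ s) \<le> h \<Longrightarrow> run D x h k (L @ s)
    \<Longrightarrow> run D x h (Suc k) (a # s)"

definition der :: "('i, 'a) dsys \<Rightarrow> 'a list \<Rightarrow> 'i \<Rightarrow> bool" where
  "der D x a \<longleftrightarrow> (\<exists>h k. run D x h k [a])"

lemma run_mono: "run D x h k s \<Longrightarrow> h \<le> h' \<Longrightarrow> k \<le> k' \<Longrightarrow> run D x h' k' s"
proof (induction arbitrary: k' rule: run.induct)
  case (run_Nil k)
  show ?case by (rule run.run_Nil)
next
  case (run_Cons L a s k)
  then obtain k'' where "k' = Suc k''" "k \<le> k''" by (cases k') auto
  with run_Cons show ?case by (auto intro!: run.run_Cons[of L])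
qed

text \<open>While \<open>s\<close> is being processed, \<open>s'\<close> waits untouched below it;
  hence \<open>h + length s'\<close>.\<close>

lemma run_append:
  assumes "run D x h k s" "run D x H k' s'" "h + length s' \<le> H"
  shows "run D x H (k + k') (s @ s')"
  using assms
proof (induction rule: run.induct)
  case (run_Nil k)
  then show ?case by (auto intro: run_mono)
next
  case (run_Cons L a s k)
  then show ?case by (auto intro!: run.run_Cons[of L])
qed

lemma run_appendD: "run D x h k (s @ s') \<Longrightarrow> run D x h k s \<and> run D x h k s'"
proof (induction k "s @ s'" arbitrary: s s' rule: run.induct)
  case (run_Nil k)
  then show ?case by (auto intro: run.run_Nil)
next
  case (run_Cons L a r k)
  show ?case
  proof (cases s)
    case Nil
    with run_Cons.hyps have "s' = a # r" by simp
    then show ?thesis using run_Cons Nil by (auto intro: run.intros)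
  next
    case (Cons b t)
    with run_Cons have "b = a" "r = t @ s'" by auto
    moreover from this run_Cons.hyps(4)[of "L @ t" s'] have "run D x h k (L @ t) \<and> run D x h k s'"
      by simp
    ultimately show ?thesis using run_Cons Cons
      by (auto intro!: run.run_Cons[of L] intro: run_mono[of D x h k _ h "Suc k"])
  qed
qed

lemma run_imp_der: "run D x h k s \<Longrightarrow> a \<in> set s \<Longrightarrow> der D x a"
proof (induction s)
  case (Cons b s)
  have "run D x h k ([b] @ s)" using Cons.prems by simp
  then have "run D x h k [b]" "run D x h k s" using run_appendD by blast+
  then show ?case using Cons by (auto simp: der_def)
qed simp

lemma der_imp_run: "\<forall>a \<in> set s. der D x a \<Longrightarrow> \<exists>h k. run D x h k s"
proof (induction s)
  case (Cons b s)
  then obtain h k h' k' where *: "run D x h k s" "run D x h' k' [b]" by (auto simp: der_def)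
  have "run D x (h + h' + length s) (k' + k) ([b] @ s)"
    by (rule run_append[OF *(2) run_mono[OF *(1)]]) auto
  then show ?case by auto
qed (auto intro: run_Nil)

lemma der_iff: "der D x a \<longleftrightarrow> (\<exists>L \<in> active D x a. \<forall>b \<in> set L. der D x b)"
proof
  assume "der D x a"
  then obtain h k where "run D x h k [a]" by (auto simp: der_def)
  then show "\<exists>L \<in> active D x a. \<forall>b \<in> set L. der D x b"
    by cases (auto dest: run_imp_der)
next
  assume "\<exists>L \<in> active D x a. \<forall>b \<in> set L. der D x b"
  then obtain L h k where L: "L \<in> active D x a" and r: "run D x h k L"
    using der_imp_run by meson
  have "run D x (h + length L) (Suc k) [a]"
    by (rule run_Cons[OF L]) (use run_mono[OF r, of "h + length L" k] in auto)
  then show "der D x a" unfolding der_def by blast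
qed

lemma der_induct [consumes 1, case_names rule]:
  assumes "der D x a"
    and step: "\<And>a L. L \<in> active D x a \<Longrightarrow> (\<And>b. b \<in> set L \<Longrightarrow> der D x b)
      \<Longrightarrow> (\<And>b. b \<in> set L \<Longrightarrow> P b) \<Longrightarrow> P a"
  shows "P a"
proof -
  have "\<forall>a \<in> set s. P a" if "run D x h k s" for h k s
    using that
  proof (induction rule: run.induct)
    case (run_Cons L a s k)
    have "P a" using step[OF run_Cons.hyps(1)] run_imp_der[OF run_Cons.hyps(3)] run_Cons.IH by auto
    with run_Cons.IH show ?case by auto
  qed simp
  with assms(1) show ?thesis by (auto simp: der_def)
qed

text \<open>A weight that exceeds the total weight of the premises bounds the size of the derivation
  tree, and this size is the number of rule applications.\<close>

lemma der_run_weight: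
  assumes weight: "\<And>a L. L \<in> active D x a \<Longrightarrow> a \<in> A \<Longrightarrow>
      set L \<subseteq> A \<and> sum_list (map W L) < (W a :: nat)"
    and "der D x a" "a \<in> A"
  shows "\<exists>h. run D x h (W a) [a]"
proof -
  have runs: "\<exists>h. run D x h (sum_list (map W s)) s" if "\<forall>b \<in> set s. \<exists>h. run D x h (W b) [b]" for s
    using that
  proof (induction s)
    case (Cons b s)
    then obtain h h' where *: "run D x h (sum_list (map W s)) s" "run D x h' (W b) [b]" by auto
    have "run D x (h + h' + length s) (W b + sum_list (map W s)) ([b] @ s)"
      by (rule run_append[OF *(2) run_mono[OF *(1)]]) auto
    then show ?case by auto
  qed (auto intro: run_Nil)
  show ?thesis using assms(2,3)
  proof (induction rule: der_induct)
    case (rule a L)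
    note w = weight[OF rule.hyps(1) rule.prems]
    with rule obtain h where r: "run D x h (sum_list (map W L)) L" using runs[of L] by blast
    obtain k where k: "W a = Suc k" "sum_list (map W L) \<le> k" using w by (cases "W a") auto
    have "run D x (h + length L) (Suc k) [a]"
      by (rule run_Cons[OF rule.hyps(1)]) (use run_mono[OF r] k in auto)
    then show ?case using k by auto
  qed
qed

text \<open>While premise \<open>j\<close> is being solved, the \<open>length L - Suc j\<close>
  later premises wait beneath it. The last premise may be as high as the conclusion, so chains of
  tail goals cost no height.\<close>

lemma der_run_height:
  assumes height: "\<And>a L. L \<in> active D x a \<Longrightarrow>
      length L \<le> H a \<and> (\<forall>j < length L. H (L ! j) + (length L - Suc j) \<le> H a)"
    and "der D x a"
  shows "\<exists>k. run D x (H a) k [a]"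
proof -
  have runs: "\<exists>k. run D x h k s"
    if "\<forall>b \<in> set s. \<exists>k. run D x (H b) k [b]"
      "\<forall>j < length s. H (s ! j) + (length s - Suc j) \<le> h" for s h
    using that
  proof (induction s)
    case (Cons b s)
    have "\<forall>j < length s. H (s ! j) + (length s - Suc j) \<le> h"
      using Cons.prems(2) by (metis Suc_mono diff_Suc_Suc length_Cons nth_Cons_Suc)
    moreover have "H b + length s \<le> h" using Cons.prems(2) by force
    ultimately obtain k k' where *: "run D x h k s" "run D x (H b) k' [b]" using Cons by auto
    have "run D x h (k' + k) ([b] @ s)"
      by (rule run_append[OF *(2,1)]) fact
    then show ?case by auto
  qed (auto intro: run_Nil)
  show ?thesis using assms(2)
  proof (induction rule: der_induct)
    case (rule a L)
    then obtain k where r: "run D x (H a) k L" using runs[of L "H a"] height by blast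
    have "run D x (H a) (Suc k) [a]"
      by (rule run_Cons[OF rule.hyps(1)]) (use r height[OF rule.hyps(1)] in auto)
    then show ?case by auto
  qed
qed


section \<open>Complementing a derivation system by inductive counting\<close>

text \<open>Counting visits the items, and the candidate premise lists, in some order; any
  enumeration will do.\<close>

definition nth_elem :: "'b set \<Rightarrow> nat \<Rightarrow> 'b" where
  "nth_elem A = (SOME e. bij_betw e {..<card A} A)"

lemma bij_betw_nth_elem: "finite A \<Longrightarrow> bij_betw (nth_elem A) {..<card A} A"
  unfolding nth_elem_def atLeast0LessThan[symmetric] by (rule someI_ex[OF ex_bij_betw_nat_finite])

abbreviation short_lists :: "'b set \<Rightarrow> 'b list set" where
  "short_lists A \<equiv> {L. set L \<subseteq> A \<and> length L \<le> 2}"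

text \<open>The items of the complement system. \<open>Member l a\<close>: \<open>a\<close> belongs to level \<open>l\<close>, that is, it is
  derivable in at most \<open>l\<close> rounds. \<open>Find l a k i\<close>: level \<open>l\<close> contains \<open>k\<close> items other than \<open>a\<close>
  whose index is at least \<open>i\<close>. \<open>Refute l c a m\<close>: level \<open>l\<close> has \<open>c\<close> members and no premise list
  of index at least \<open>m\<close> puts \<open>a\<close> into level \<open>l + 1\<close>. \<open>Count l c k i\<close>: the root is underivable,
  given that level \<open>l\<close> has \<open>c\<close> members and that \<open>k\<close> items of index less than \<open>i\<close> are in level \<open>l + 1\<close>.\<close>

datatype 'i node = Member nat 'i | Find nat 'i nat nat | Refute nat nat 'i nat | Count nat nat nat nat

context
  fixes D :: "('i, 'a) dsys"
begin

abbreviation "num \<equiv> card (ds_items D)"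
abbreviation "num_lists \<equiv> card (short_lists (ds_items D))"

text \<open>\<open>Find\<close> may pass over members and so certifies only a lower bound, which
  suffices once \<open>c\<close> is the exact size of the level. An active rule without premises
  leaves \<open>Refute\<close> no \<open>b\<close> to choose, as it should. Continuations come last,
  which makes them tail goals.\<close>

fun cosys_rules :: "'i node \<Rightarrow> 'a tape_symbol \<Rightarrow> 'i node list set" where
  "cosys_rules (Member l a) \<sigma> = (case l of 0 \<Rightarrow> {} | Suc l' \<Rightarrow> map (Member l') ` ds_rules D a \<sigma>)"
| "cosys_rules (Find l a k i) \<sigma> =
    (if k = 0 then {[]}
     else if i < num then
       insert [Find l a k (Suc i)]
         (if nth_elem (ds_items D) i = a then {}
          else {[Member l (nth_elem (ds_items D) i), Find l a (k - 1) (Suc i)]})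
     else {})"
| "cosys_rules (Refute l c a m) \<sigma> =
    (if m < num_lists then
       if nth_elem (short_lists (ds_items D)) m \<in> ds_rules D a \<sigma>
       then {[Find l b c 0, Refute l c a (Suc m)] | b. b \<in> set (nth_elem (short_lists (ds_items D)) m)}
       else {[Refute l c a (Suc m)]}
     else {[]})"
| "cosys_rules (Count l c k i) \<sigma> =
    (if i < num then
       {[Member (Suc l) (nth_elem (ds_items D) i), Count l c (Suc k) (Suc i)],
        [Refute l c (nth_elem (ds_items D) i) 0, Count l c k (Suc i)]}
     else if Suc l < num then {[Count (Suc l) k 0 0]}
     else {[Find (Suc l) (ds_root D) k 0]})"

text \<open>Only \<open>Member\<close> and \<open>Refute\<close> consult rules of \<open>D\<close>
  and hence the tape; the position of the other nodes is arbitrary.\<close>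

fun cosys_pos :: "'i node \<Rightarrow> nat" where
  "cosys_pos (Member l a) = ds_pos D a"
| "cosys_pos (Refute l c a m) = ds_pos D a"
| "cosys_pos _ = 0"

text \<open>The condition \<open>k \<le> i\<close> on \<open>Count\<close> nodes keeps the
  incremented counter within \<open>num\<close>.\<close>

definition cosys_items :: "'i node set" where
  "cosys_items =
     (\<lambda>(l, a). Member l a) ` ({..num} \<times> ds_items D) \<union>
     (\<lambda>(l, a, k, i). Find l a k i) ` ({..num} \<times> ds_items D \<times> {..num} \<times> {..num}) \<union>
     (\<lambda>(l, c, a, m). Refute l c a m) ` ({..num} \<times> {..num} \<times> ds_items D \<times> {..num_lists}) \<union>
     (\<lambda>(l, c, k, i). Count l c k i) ` ({(l, c, k, i). l < num \<and> c \<le> num \<and> k \<le> i \<and> i \<le> num})"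

definition cosys :: "('i node, 'a) dsys" where
  "cosys = \<lparr>ds_items = cosys_items, ds_pos = cosys_pos, ds_rules = cosys_rules, ds_root = Count 0 0 0 0\<rparr>"

lemma cosys_simps [simp]:
  "ds_items cosys = cosys_items" "ds_pos cosys = cosys_pos" "ds_rules cosys = cosys_rules"
  "ds_root cosys = Count 0 0 0 0"
  by (simp_all add: cosys_def)

primrec lev :: "'a list \<Rightarrow> nat \<Rightarrow> 'i set" where
  "lev x 0 = {}"
| "lev x (Suc l) = {a \<in> ds_items D. \<exists>L \<in> active D x a. set L \<subseteq> lev x l}"

lemma cosys_items_iff [simp]:
  "Member l a \<in> cosys_items \<longleftrightarrow> l \<le> num \<and> a \<in> ds_items D"
  "Find l a k i \<in> cosys_items \<longleftrightarrow> l \<le> num \<and> a \<in> ds_items D \<and> k \<le> num \<and> i \<le> num"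
  "Refute l c a m \<in> cosys_items \<longleftrightarrow> l \<le> num \<and> c \<le> num \<and> a \<in> ds_items D \<and> m \<le> num_lists"
  "Count l c k i \<in> cosys_items \<longleftrightarrow> l < num \<and> c \<le> num \<and> k \<le> i \<and> i \<le> num"
  by (auto simp: cosys_items_def image_iff)

lemma lev_subset: "lev x l \<subseteq> ds_items D"
  by (cases l) auto

lemma mono_lev: "mono (lev x)"
proof (unfold mono_iff_le_Suc, intro allI)
  fix l show "lev x l \<subseteq> lev x (Suc l)"
  proof (induction l)
    case (Suc l)
    show ?case
    proof
      fix a assume "a \<in> lev x (Suc l)"
      then obtain L where "a \<in> ds_items D" "L \<in> active D x a" "set L \<subseteq> lev x l" by auto
      with Suc show "a \<in> lev x (Suc (Suc l))" by (subst lev.simps(2)) blast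
    qed
  qed simp
qed

section \<open>Correctness of the counting system\<close>

context
  fixes B :: nat
  assumes wf: "ds_wf B D"
begin

lemma finite_ds_items: "finite (ds_items D)" and root_in_items: "ds_root D \<in> ds_items D"
  and rule_short: "a \<in> ds_items D \<Longrightarrow> L \<in> ds_rules D a \<sigma> \<Longrightarrow> L \<in> short_lists (ds_items D)"
  and pos_le: "a \<in> ds_items D \<Longrightarrow> ds_pos D a \<le> B"
  using wf unfolding ds_wf_def by auto

lemma num_pos: "0 < num"
  using finite_ds_items root_in_items by (auto simp: card_gt_0_iff)

lemma finite_short_lists: "finite (short_lists (ds_items D))"
  using finite_lists_length_le[OF finite_ds_items] .

lemma nth_elem_items: "i < num \<Longrightarrow> nth_elem (ds_items D) i \<in> ds_items D"
  using bij_betw_nth_elem[OF finite_ds_items] by (auto simp: bij_betw_def)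

lemma nth_elem_lists: "m < num_lists \<Longrightarrow> nth_elem (short_lists (ds_items D)) m \<in> short_lists (ds_items D)"
  using bij_betw_nth_elem[OF finite_short_lists] by (auto simp: bij_betw_def)

text \<open>In an increasing chain of subsets of a set with \<open>num\<close> elements, where each
  level determines the next, nothing changes after step \<open>num\<close>. So counting up to this
  level is enough.\<close>

lemma lev_num: "lev x num = {a \<in> ds_items D. der D x a}"
proof -
  have union: "lev x num = (\<Union>l. lev x l)"
  proof (intro finite_mono_strict_prefix_implies_finite_fixpoint
      finite_mono_remains_stable_implies_strict_prefix)
    show "finite (range (lev x))"
      by (rule finite_subset[of _ "Pow (ds_items D)"]) (use lev_subset finite_ds_items in auto)
    show "\<forall>n. lev x n = lev x (Suc n) \<longrightarrow> lev x (Suc n) = lev x (Suc (Suc n))"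
      by auto
  qed (use lev_subset finite_ds_items mono_lev in auto)
  have sound: "der D x a" if "a \<in> lev x l" for a l
    using that
  proof (induction l arbitrary: a)
    case (Suc l)
    then show ?case by (subst der_iff) auto
  qed simp
  have complete: "a \<in> ds_items D \<longrightarrow> (\<exists>l. a \<in> lev x l)" if "der D x a" for a
    using that
  proof (induction rule: der_induct)
    case (rule a L)
    show ?case
    proof
      assume a: "a \<in> ds_items D"
      have "\<forall>b \<in> set L. \<exists>l. b \<in> lev x l" using rule rule_short[OF a rule(1)] by auto
      then obtain f where f: "b \<in> lev x (f b)" if "b \<in> set L" for b by metis
      \<comment> \<open>The premises may appear at different levels; the sum serves as a common
        upper bound.\<close>
      have "b \<in> lev x (\<Sum>b \<in> set L. f b)" if "b \<in> set L" for b
      proof -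
        have "f b \<le> (\<Sum>b \<in> set L. f b)" using that by (simp add: member_le_sum)
        then show ?thesis using f[OF that] mono_lev[of x] by (auto simp: mono_def)
      qed
      then have "a \<in> lev x (Suc (\<Sum>b \<in> set L. f b))" using rule(1) a by auto
      then show "\<exists>l. a \<in> lev x l" ..
    qed
  qed
  show ?thesis
  proof (intro subset_antisym subsetI)
    fix a assume "a \<in> lev x num"
    then show "a \<in> {a \<in> ds_items D. der D x a}" using lev_subset sound by auto
  next
    fix a assume "a \<in> {a \<in> ds_items D. der D x a}"
    then show "a \<in> lev x num" unfolding union using complete by auto
  qed
qed

lemma der_Member: "a \<in> ds_items D \<Longrightarrow> der cosys x (Member l a) \<longleftrightarrow> a \<in> lev x l"
proof (induction l arbitrary: a)
  case 0
  show ?case by (subst der_iff) simp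
next
  case (Suc l)
  have "(\<forall>b \<in> set L. der cosys x (Member l b)) \<longleftrightarrow> set L \<subseteq> lev x l"
    if "L \<in> active D x a" for L
    using rule_short[OF Suc.prems that] Suc.IH by auto
  then show ?case using Suc.prems by (subst der_iff) auto
qed

text \<open>Passing over a member is always allowed, which is why an inequality characterises
  derivability.\<close>

lemma der_Find:
  "der cosys x (Find l a k i) \<longleftrightarrow>
     k \<le> card {j. i \<le> j \<and> j < num \<and> nth_elem (ds_items D) j \<noteq> a \<and> nth_elem (ds_items D) j \<in> lev x l}"
proof (induction "num - i" arbitrary: i k)
  case 0
  then have *: "{j. i \<le> j \<and> j < num \<and> nth_elem (ds_items D) j \<noteq> a \<and> nth_elem (ds_items D) j \<in> lev x l} = {}"
    by auto
  show ?case unfolding * using 0 by (subst der_iff) simp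
next
  case (Suc n)
  let ?S = "\<lambda>i. {j. i \<le> j \<and> j < num \<and> nth_elem (ds_items D) j \<noteq> a \<and> nth_elem (ds_items D) j \<in> lev x l}"
  have i: "i < num" "n = num - Suc i" using Suc.hyps(2) by auto
  have S: "?S i = (if nth_elem (ds_items D) i \<noteq> a \<and> nth_elem (ds_items D) i \<in> lev x l
      then insert i (?S (Suc i)) else ?S (Suc i))"
    using i by (auto simp: Suc_le_eq le_less)
  have "card (?S i) = (if nth_elem (ds_items D) i \<noteq> a \<and> nth_elem (ds_items D) i \<in> lev x l
      then Suc (card (?S (Suc i))) else card (?S (Suc i)))"
    unfolding S by auto
  then show ?case
    using i Suc.hyps(1)[OF i(2)] der_Member[OF nth_elem_items[OF i(1)]]
    by (subst der_iff) auto
qed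

lemma card_nth_elem: "A \<subseteq> ds_items D \<Longrightarrow> card {j. j < num \<and> nth_elem (ds_items D) j \<in> A} = card A"
proof (rule bij_betw_same_card[of "nth_elem (ds_items D)"])
  assume "A \<subseteq> ds_items D"
  then show "bij_betw (nth_elem (ds_items D)) {j. j < num \<and> nth_elem (ds_items D) j \<in> A} A"
    using bij_betw_nth_elem[OF finite_ds_items] unfolding bij_betw_def inj_on_def by (auto simp: image_iff)
qed

text \<open>The core of inductive counting: if \<open>a\<close> is in the level, there is one other
  member too few and the search fails. Non-membership has become an existential statement.\<close>

lemma der_Find_count: "der cosys x (Find l a (card (lev x l)) 0) \<longleftrightarrow> a \<notin> lev x l"
proof -
  have *: "{j. 0 \<le> j \<and> j < num \<and> nth_elem (ds_items D) j \<noteq> a \<and> nth_elem (ds_items D) j \<in> lev x l}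
      = {j. j < num \<and> nth_elem (ds_items D) j \<in> lev x l - {a}}" by auto
  have **: "card {j. j < num \<and> nth_elem (ds_items D) j \<in> lev x l - {a}} = card (lev x l - {a})"
    using lev_subset[of x l] by (intro card_nth_elem) auto
  have "der cosys x (Find l a (card (lev x l)) 0) \<longleftrightarrow> card (lev x l) \<le> card (lev x l - {a})"
    unfolding der_Find * ** ..
  also have "\<dots> \<longleftrightarrow> a \<notin> lev x l"
    using finite_subset[OF lev_subset finite_ds_items, of x l] card_Diff1_less[of "lev x l" a]
    by (cases "a \<in> lev x l") (auto simp del: card_Diff_singleton)
  finally show ?thesis .
qed

text \<open>One premise outside the level disables a premise list, and \<open>der_Find_count\<close>
  certifies such a premise; this is where exactness of \<open>c\<close> is used.\<close>

lemma der_Refute: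
  assumes c: "c = card (lev x l)"
  shows "der cosys x (Refute l c a m) \<longleftrightarrow>
     (\<forall>m' \<in> {m..<num_lists}. nth_elem (short_lists (ds_items D)) m' \<in> active D x a \<longrightarrow>
        \<not> set (nth_elem (short_lists (ds_items D)) m') \<subseteq> lev x l)"
proof (induction "num_lists - m" arbitrary: m)
  case 0
  then show ?case by (subst der_iff) simp
next
  case (Suc n)
  then have m: "m < num_lists" "n = num_lists - Suc m" by auto
  then have *: "{m..<num_lists} = insert m {Suc m..<num_lists}" by auto
  let ?L = "nth_elem (short_lists (ds_items D)) m"
  have "(\<exists>b \<in> set ?L. der cosys x (Find l b c 0)) \<longleftrightarrow> \<not> set ?L \<subseteq> lev x l"
    using der_Find_count[of x l] c by auto
  then have "der cosys x (Refute l c a m) \<longleftrightarrow>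
      (?L \<in> active D x a \<longrightarrow> \<not> set ?L \<subseteq> lev x l) \<and> der cosys x (Refute l c a (Suc m))"
    using m by (subst der_iff) auto
  then show ?case unfolding Suc.hyps(1)[OF m(2)] * by auto
qed

lemma der_Refute_count:
  assumes a: "a \<in> ds_items D"
  shows "der cosys x (Refute l (card (lev x l)) a 0) \<longleftrightarrow> a \<notin> lev x (Suc l)"
proof -
  have "(\<exists>L \<in> active D x a. set L \<subseteq> lev x l) \<longleftrightarrow>
    (\<exists>m < num_lists. nth_elem (short_lists (ds_items D)) m \<in> active D x a \<and>
       set (nth_elem (short_lists (ds_items D)) m) \<subseteq> lev x l)" (is "?l \<longleftrightarrow> ?r")
  proof
    assume ?l
    then obtain L where L: "L \<in> active D x a" "set L \<subseteq> lev x l" by auto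
    have "L \<in> nth_elem (short_lists (ds_items D)) ` {..<num_lists}"
      using rule_short[OF a L(1)] bij_betw_nth_elem[OF finite_short_lists] by (auto simp: bij_betw_def)
    then show ?r using L by auto
  qed blast
  then show ?thesis using a unfolding der_Refute[OF refl] by auto
qed

text \<open>Describing the nodes with correct counters suffices: from such a node exactly one of the
  two counting rules has a derivable first premise, and its continuation has correct counters again.
  The outer induction runs over the remaining levels, the inner one over the remaining
  indices.\<close>

lemma der_Count:
  assumes "l < num" "i \<le> num"
  shows "der cosys x (Count l (card (lev x l))
      (card {j. j < i \<and> nth_elem (ds_items D) j \<in> lev x (Suc l)}) i) \<longleftrightarrow> \<not> der D x (ds_root D)"
  using assms
proof (induction "num - l" arbitrary: l i)
  case (Suc n)
  note outer = Suc
  from Suc.prems(2) show ?case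
  proof (induction "num - i" arbitrary: i)
    case 0
    then have i: "i = num" by simp
    have cnt: "card {j. j < num \<and> nth_elem (ds_items D) j \<in> lev x (Suc l)} = card (lev x (Suc l))"
      by (rule card_nth_elem[OF lev_subset])
    show ?case
    proof (cases "Suc l < num")
      case True
      then have "der cosys x (Count (Suc l) (card (lev x (Suc l))) 0 0) \<longleftrightarrow> \<not> der D x (ds_root D)"
        using outer(1)[of "Suc l" 0] outer(2) by simp
      then show ?thesis using True i cnt by (subst der_iff) simp
    next
      case False
      \<comment> \<open>The last level holds all derivable items, so finding its full number of
        members while avoiding the root refutes the root.\<close>
      then have "Suc l = num" using outer(3) by simp
      then have "der cosys x (Find (Suc l) (ds_root D) (card (lev x (Suc l))) 0) \<longleftrightarrow>
          \<not> der D x (ds_root D)"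
        unfolding der_Find_count using lev_num[of x] root_in_items by simp
      then show ?thesis using False i cnt by (subst der_iff) simp
    qed
  next
    case (Suc k)
    then have i: "i < num" "k = num - Suc i" by auto
    let ?C = "\<lambda>i. card {j. j < i \<and> nth_elem (ds_items D) j \<in> lev x (Suc l)}"
    have S: "{j. j < Suc i \<and> nth_elem (ds_items D) j \<in> lev x (Suc l)} =
      (if nth_elem (ds_items D) i \<in> lev x (Suc l)
       then insert i {j. j < i \<and> nth_elem (ds_items D) j \<in> lev x (Suc l)}
       else {j. j < i \<and> nth_elem (ds_items D) j \<in> lev x (Suc l)})"
      by (auto simp: less_Suc_eq)
    have C: "?C (Suc i) = (if nth_elem (ds_items D) i \<in> lev x (Suc l) then Suc (?C i) else ?C i)"
      unfolding S by auto
    have IH: "der cosys x (Count l (card (lev x l)) (?C (Suc i)) (Suc i)) \<longleftrightarrow> \<not> der D x (ds_root D)"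
      using Suc.hyps(1)[OF i(2)] i by simp
    note P = der_Member[OF nth_elem_items[OF i(1)], of x "Suc l"]
    note A = der_Refute_count[OF nth_elem_items[OF i(1)], of x l]
    show ?case
      using i IH P A C by (subst der_iff) (auto simp del: lev.simps split: if_splits)
  qed
qed simp

theorem der_cosys: "der cosys x (ds_root cosys) \<longleftrightarrow> \<not> der D x (ds_root D)"
  using der_Count[OF num_pos, of 0 x] by simp

lemma wf_cosys: "ds_wf B cosys"
proof -
  have fin_items: "finite cosys_items"
  proof -
    have "{(l, c, k, i). l < num \<and> c \<le> num \<and> k \<le> i \<and> i \<le> num} \<subseteq> {..num} \<times> {..num} \<times> {..num} \<times> {..num}"
      by auto
    then have "finite {(l, c, k, i). l < num \<and> c \<le> num \<and> k \<le> i \<and> i \<le> num}"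
      by (rule finite_subset) auto
    then show ?thesis unfolding cosys_items_def using finite_ds_items by auto
  qed
  have rules: "set L \<subseteq> cosys_items \<and> length L \<le> 2"
    if "v \<in> cosys_items" "L \<in> cosys_rules v \<sigma>" for v L \<sigma>
  proof (cases v)
    case (Member l a)
    with that obtain l' L' where "l = Suc l'" "L = map (Member l') L'" "L' \<in> ds_rules D a \<sigma>" "a \<in> ds_items D"
      "l \<le> num"
      by (auto split: nat.splits)
    then show ?thesis using rule_short[of a L' \<sigma>] by auto
  next
    case (Find l a k i)
    with that show ?thesis using nth_elem_items[of i]
      by (auto split: if_splits)
  next
    case (Refute l c a m)
    have "b \<in> ds_items D" if "m < num_lists" "b \<in> set (nth_elem (short_lists (ds_items D)) m)" for b
      using nth_elem_lists[OF that(1)] that(2) by blast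
    with Refute that show ?thesis by (auto split: if_splits)
  next
    case (Count l c k i)
    with that show ?thesis using nth_elem_items[of i] root_in_items
      by (auto split: if_splits)
  qed
  have "Count 0 0 0 0 \<in> cosys_items" using num_pos by auto
  moreover have "cosys_pos v \<le> B" if "v \<in> cosys_items" for v
    using that pos_le by (cases v) auto
  ultimately show ?thesis unfolding ds_wf_def using rules fin_items by auto
qed

end

end

text \<open>One summand per kind of node; \<open>N * N + N + 1\<close> is the number of candidate
  premise lists. The formula lives in any commutative semiring, so that it can be read as a number
  and as a polynomial in \<open>n\<close>; later bounds use the same device.\<close>

definition cosys_card :: "'n::comm_semiring_1 \<Rightarrow> 'n" where
  "cosys_card N = (N + 1) * N + (N + 1) * N * (N + 1) * (N + 1)
     + (N + 1) * (N + 1) * N * (N * N + N + 1 + 1) + (N + 1) * (N + 1) * (N + 1) * (N + 1)"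

lemma card_short_lists: "finite A \<Longrightarrow> card (short_lists A) = card A * card A + card A + 1"
  unfolding card_lists_length_le by (simp add: numeral_2_eq_2)

lemma card_cosys:
  assumes "ds_wf B D"
  shows "card (ds_items (cosys D)) \<le> cosys_card (card (ds_items D))"
proof -
  let ?n = "num D"
  let ?C = "{(l, c, k, i). l < ?n \<and> c \<le> ?n \<and> k \<le> i \<and> i \<le> ?n}"
  have f: "finite (ds_items D)" using assms by (simp add: ds_wf_def)
  have sub: "?C \<subseteq> {..?n} \<times> {..?n} \<times> {..?n} \<times> {..?n}" by auto
  have "card ?C \<le> card ({..?n} \<times> {..?n} \<times> {..?n} \<times> {..?n})"
    by (rule card_mono[OF _ sub]) simp
  then have C: "card ?C \<le> (?n + 1) * (?n + 1) * (?n + 1) * (?n + 1)"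
    by (simp only: card_cartesian_product card_atMost Suc_eq_plus1 mult.assoc)
  have fC: "finite ?C" by (rule finite_subset[OF sub]) simp
  let ?A1 = "{..?n} \<times> ds_items D" and ?A2 = "{..?n} \<times> ds_items D \<times> {..?n} \<times> {..?n}"
    and ?A3 = "{..?n} \<times> {..?n} \<times> ds_items D \<times> {..num_lists D}"
  have "card (ds_items (cosys D)) \<le> card ?A1 + card ?A2 + card ?A3 + card ?C"
    unfolding cosys_simps cosys_items_def using f fC
    by (intro order.trans[OF card_Un_le] add_mono card_image_le) auto
  also have "\<dots> \<le> cosys_card ?n"
    unfolding cosys_card_def card_cartesian_product card_atMost card_short_lists[OF f]
      Suc_eq_plus1 mult.assoc
    by (intro add_mono order_refl C[unfolded mult.assoc])
  finally show ?thesis .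
qed

text \<open>Each of \<open>N\<close> indices costs at most a \<open>Member\<close> derivation of
  size \<open>T\<close> and one \<open>Find\<close> rule; the final 1 ends the search.\<close>

definition find_time :: "'n::comm_semiring_1 \<Rightarrow> 'n \<Rightarrow> 'n" where
  "find_time N T = N * (T + 1) + 1"

definition all_time :: "'n::comm_semiring_1 \<Rightarrow> 'n \<Rightarrow> 'n" where
  "all_time N T = (N * N + N + 1) * (find_time N T + 1) + 1"

text \<open>The factor \<open>N * (N + 1) + N\<close> bounds the rank of the initial
  \<open>Count\<close> node in the next proof, without subtraction. Each rank is charged for both
  alternatives of a counting step.\<close>

definition cosys_time :: "'n::comm_semiring_1 \<Rightarrow> 'n \<Rightarrow> 'n" where
  "cosys_time N T = (N * (N + 1) + N) * (T + all_time N T + find_time N T + 1) + find_time N T + 1"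

text \<open>A weight that decreases along all rules of \<open>D\<close> carries over:
  \<open>Member\<close> goals keep the weight of their item at every level, and the other nodes call
  them only polynomially often.\<close>

lemma cosys_run_weight:
  assumes wf: "ds_wf B D"
    and w: "\<And>a L \<sigma>. a \<in> ds_items D \<Longrightarrow> L \<in> ds_rules D a \<sigma> \<Longrightarrow> sum_list (map w L) < w a"
    and T: "\<And>a. a \<in> ds_items D \<Longrightarrow> w a \<le> T"
    and d: "der (cosys D) x (ds_root (cosys D))"
  shows "\<exists>h. run (cosys D) x h (cosys_time (card (ds_items D)) T) [ds_root (cosys D)]"
proof -
  let ?N = "card (ds_items D)" and ?M = "num_lists D"
  let ?F = "find_time ?N T" and ?A = "all_time ?N T"
  have f: "finite (ds_items D)" using wf by (simp add: ds_wf_def)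
  have M: "?M = ?N * ?N + ?N + 1" using card_short_lists[OF f] .
  \<comment> \<open>For \<open>Count\<close>, the factor
    \<open>(?N - l - 1) * (?N + 1) + (?N - i)\<close> ranks the pairs \<open>(l, i)\<close> in the
    order of counting; each level has \<open>?N + 1\<close> values of \<open>i\<close>. The summand
    \<open>?F\<close> pays for the final \<open>Find\<close>.\<close>
  define W where "W v = (case v of Member l a \<Rightarrow> w a | Find l a k i \<Rightarrow> (?N - i) * (T + 1) + 1
    | Refute l c a m \<Rightarrow> (?M - m) * (?F + 1) + 1
    | Count l c k i \<Rightarrow> ((?N - l - 1) * (?N + 1) + (?N - i)) * (T + ?A + ?F + 1) + ?F + 1)" for v
  have WF: "W (Find l a k 0) = ?F" for l a k by (simp add: W_def find_time_def)
  have WA: "W (Refute l c a 0) = ?A" for l c a by (simp add: W_def all_time_def M)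
  have step: "(p - i) * t = (p - Suc i) * t + t" if "i < p" for p i t :: nat
    using that by (metis Suc_diff_Suc add.commute mult_Suc)
  have "set L \<subseteq> ds_items (cosys D) \<and> sum_list (map W L) < W v"
    if L: "L \<in> active (cosys D) x v" and v: "v \<in> ds_items (cosys D)" for v L
  proof
    show "set L \<subseteq> ds_items (cosys D)" using wf_cosys[OF wf] L v by (auto simp: ds_wf_def)
    show "sum_list (map W L) < W v"
    proof (cases v)
      case (Member l a)
      then have "map W (map (Member l') L') = map w L'" for l' L' by (simp add: W_def)
      then show ?thesis using Member L v w[of a]
        by (auto simp: W_def o_def split: nat.splits)
    next
      case (Find l a k i)
      have P: "W (Member l (nth_elem (ds_items D) i)) \<le> T" if "i < ?N"
        using T[OF nth_elem_items[OF wf that]] by (simp add: W_def)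
      have *: "W (Find l a k' i) = W (Find l a k'' (Suc i)) + (T + 1)" if "i < ?N" for k' k''
        unfolding W_def node.case using step[OF that, of "T + 1"] by linarith
      have "W (Find l a k i) > 0" by (simp add: W_def)
      then show ?thesis using Find L P *[of k k] *[of k "k - 1"] by (auto split: if_splits)
    next
      case (Refute l c a m)
      have *: "W (Refute l c a m) = W (Refute l c a (Suc m)) + (?F + 1)" if "m < ?M"
        unfolding W_def node.case using step[OF that, of "?F + 1"] by linarith
      have "W (Refute l c a m) > 0" by (simp add: W_def)
      then show ?thesis using Refute L * WF by (auto split: if_splits)
    next
      case (Count l c k i)
      have l: "l < ?N" "i \<le> ?N" using v Count by auto
      let ?X = "T + ?A + ?F + 1"
      show ?thesis
      proof (cases "i < ?N")
        case True
        let ?R = "(?N - l - 1) * (?N + 1)"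
        have *: "W (Count l c k' i) = W (Count l c k'' (Suc i)) + ?X" for k' k''
          unfolding W_def node.case add_mult_distrib using step[OF True, of ?X] by linarith
        have P: "W (Member (Suc l) (nth_elem (ds_items D) i)) \<le> T"
          using T[OF nth_elem_items[OF wf True]] by (simp add: W_def)
        from L True Count consider
            "L = [Member (Suc l) (nth_elem (ds_items D) i), Count l c (Suc k) (Suc i)]"
          | "L = [Refute l c (nth_elem (ds_items D) i) 0, Count l c k (Suc i)]" by auto
        then show ?thesis
        proof cases
          case 1
          then show ?thesis using P *[of k "Suc k"] Count by simp
        next
          case 2
          then show ?thesis using *[of k k] Count WA by simp
        qed
      next
        case False
        then have i: "i = ?N" using l by simp
        show ?thesis
        proof (cases "Suc l < ?N")
          case True
          then have "(?N - l - 1) * (?N + 1) = (?N - Suc l - 1) * (?N + 1) + (?N + 1)"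
            using step[of "Suc l" ?N "?N + 1"] by simp
          \<comment> \<open>The first summand falls by \<open>?N + 1\<close> and the second rises
            from 0 to \<open>?N\<close>, so the rank drops by exactly one.\<close>
          then have "(?N - Suc l - 1) * (?N + 1) + (?N - 0) < (?N - l - 1) * (?N + 1) + (?N - i)"
            using i by simp
          then have "((?N - Suc l - 1) * (?N + 1) + (?N - 0)) * ?X
              < ((?N - l - 1) * (?N + 1) + (?N - i)) * ?X"
            by (rule mult_strict_right_mono) simp
          then have "W (Count (Suc l) k 0 0) < W v" using Count unfolding W_def by simp
          then show ?thesis using L True False Count by simp
        next
          case False
          then have "L = [Find (Suc l) (ds_root D) k 0]" using L i Count by simp
          moreover have "?F < W v" using Count by (simp add: W_def)
          ultimately show ?thesis by (simp add: WF)
        qed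
      qed
    qed
  qed
  moreover have "ds_root (cosys D) \<in> ds_items (cosys D)" using wf_cosys[OF wf] by (simp add: ds_wf_def)
  ultimately obtain h where r: "run (cosys D) x h (W (ds_root (cosys D))) [ds_root (cosys D)]"
    using der_run_weight[of "cosys D" x "ds_items (cosys D)" W, OF _ d] by blast
  have "((?N - 0 - 1) * (?N + 1) + (?N - 0)) \<le> ?N * (?N + 1) + ?N"
    by (intro add_mono mult_right_mono) auto
  then have "W (ds_root (cosys D)) \<le> cosys_time ?N T"
    unfolding W_def cosys_time_def cosys_simps node.case by (intro add_mono mult_right_mono) auto
  with r show ?thesis using run_mono by blast
qed

text \<open>A linear \<open>Member\<close> goal runs in height 1. Each of \<open>Find\<close>,
  \<open>Refute\<close> and \<open>Count\<close> adds one, since its continuation waits below a goal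
  of an earlier kind; the continuation itself is a tail goal and adds nothing. This gives 4.\<close>

lemma cosys_run_height:
  assumes linear: "\<And>a L \<sigma>. L \<in> ds_rules D a \<sigma> \<Longrightarrow> length L \<le> 1"
    and d: "der (cosys D) x (ds_root (cosys D))"
  shows "\<exists>k. run (cosys D) x 4 k [ds_root (cosys D)]"
proof -
  define H :: "'a node \<Rightarrow> nat" where
    "H v = (case v of Member l a \<Rightarrow> 1 | Find l a k i \<Rightarrow> 2 | Refute l c a m \<Rightarrow> 3 | Count l c k i \<Rightarrow> 4)" for v
  have "length L \<le> H v \<and> (\<forall>j < length L. H (L ! j) + (length L - Suc j) \<le> H v)"
    if "L \<in> active (cosys D) x v" for v L
  proof (cases v)
    case (Member l a)
    with that obtain l' L' where "L = map (Member l') L'" "length L' \<le> 1"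
      using linear by (auto split: nat.splits)
    then show ?thesis using Member by (auto simp: H_def)
  qed (use that in \<open>auto simp: H_def less_Suc_eq split: if_splits\<close>)
  from der_run_height[OF this d] show ?thesis by (simp add: H_def)
qed


section \<open>Renaming items and budgets\<close>

text \<open>Machines use natural numbers as states and stack symbols, whereas items have nested
  types. Runs are preserved with the same \<open>h\<close> and \<open>k\<close>, since derivability
  alone would lose the resource bounds.\<close>

lemma rename_dsys:
  fixes D :: "('i, 'a) dsys"
  assumes wf: "ds_wf B D"
  obtains D' :: "(nat, 'a) dsys"
  where "ds_items D' = {..<card (ds_items D)}" "ds_wf B D'"
    "\<And>x h k. run D' x h k [ds_root D'] \<longleftrightarrow> run D x h k [ds_root D]"
proof -
  define N where "N = card (ds_items D)"
  define f where "f = nth_elem (ds_items D)"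
  define g where "g = inv_into {..<N} f"
  have bij: "bij_betw f {..<N} (ds_items D)"
    unfolding f_def N_def using wf by (intro bij_betw_nth_elem) (simp add: ds_wf_def)
  have f: "f i \<in> ds_items D" "g (f i) = i" if "i < N" for i
    using that bij unfolding g_def by (auto simp: bij_betw_def)
  have g: "g a < N" "f (g a) = a" if "a \<in> ds_items D" for a
    using that bij inv_into_into[of a f "{..<N}"] f_inv_into_f[of a f "{..<N}"]
    unfolding g_def by (auto simp: bij_betw_def)
  define D' :: "(nat, 'a) dsys" where "D' = \<lparr>ds_items = {..<N}, ds_pos = ds_pos D \<circ> f,
    ds_rules = (\<lambda>i \<sigma>. map g ` ds_rules D (f i) \<sigma>), ds_root = g (ds_root D)\<rparr>"
  have prem: "set L \<subseteq> ds_items D \<and> length L \<le> 2" if "L \<in> ds_rules D a \<sigma>" "a \<in> ds_items D" for L a \<sigma>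
    using wf that by (auto simp: ds_wf_def)
  have root: "ds_root D \<in> ds_items D" using wf by (simp add: ds_wf_def)
  have 1: "run D' x h k (map g s)" if "run D x h k s" "set s \<subseteq> ds_items D" for x h k s
    using that
  proof (induction rule: run.induct)
    case (run_Cons L a s k)
    then have "map g L \<in> active D' x (g a)" by (auto simp: D'_def g)
    then show ?case using run_Cons prem[OF run_Cons(1)] by (auto intro!: run.run_Cons[of "map g L"])
  qed (simp add: run_Nil)
  have 2: "run D x h k (map f s)" if "run D' x h k s" "set s \<subseteq> {..<N}" for x h k s
    using that
  proof (induction rule: run.induct)
    case (run_Cons L a s k)
    then obtain L' where L': "L = map g L'" "L' \<in> active D x (f a)" by (auto simp: D'_def)
    with run_Cons.prems have *: "set L' \<subseteq> ds_items D" using prem[OF L'(2)] f(1)[of a] by auto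
    then have "map f L = L'" using g(2) unfolding L'(1) by (auto intro!: map_idI simp: subset_eq)
    moreover have "set (L @ s) \<subseteq> {..<N}" using L'(1) * run_Cons.prems g(1) by auto
    ultimately show ?case using run_Cons L'(2) L'(1) by (auto intro!: run.run_Cons[of L'])
  qed (simp add: run_Nil)
  have "run D' x h k [ds_root D'] \<longleftrightarrow> run D x h k [ds_root D]" for x h k
    using 1[of x h k "[ds_root D]"] 2[of x h k "[ds_root D']"] root g by (auto simp: D'_def)
  moreover have "set (map g L) \<subseteq> {..<N} \<and> length L \<le> 2" if "i < N" "L \<in> ds_rules D (f i) \<sigma>" for i L \<sigma>
    using prem[OF that(2) f(1)[OF that(1)]] g(1) by auto
  then have "ds_wf B D'"
    unfolding ds_wf_def using wf g(1) f(1) root by (auto simp: D'_def ds_wf_def)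
  ultimately show thesis using that[of D'] by (simp add: D'_def N_def)
qed

text \<open>The strict inequality reserves one unit for the rule itself. With the allowance inside
  the item, there is a weight that decreases along every rule even if \<open>D\<close> has cyclic
  rules.\<close>

definition budget :: "nat \<Rightarrow> ('i, 'a) dsys \<Rightarrow> ('i \<times> nat, 'a) dsys" where
  "budget T D = \<lparr>ds_items = ds_items D \<times> {..T}, ds_pos = ds_pos D \<circ> fst,
     ds_rules = (\<lambda>(a, b) \<sigma>. {zip L bs | L bs. L \<in> ds_rules D a \<sigma> \<and> length bs = length L \<and>
       sum_list bs < b}),
     ds_root = (ds_root D, T)\<rparr>"

lemma budget_simps [simp]:
  "ds_items (budget T D) = ds_items D \<times> {..T}" "ds_pos (budget T D) (a, b) = ds_pos D a"
  "ds_root (budget T D) = (ds_root D, T)"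
  "ds_rules (budget T D) (a, b) \<sigma> = {zip L bs | L bs. L \<in> ds_rules D a \<sigma> \<and> length bs = length L \<and>
       sum_list bs < b}"
  by (simp_all add: budget_def)

lemma wf_budget:
  assumes "ds_wf B D"
  shows "ds_wf B (budget T D)"
proof -
  have le: "b \<le> T" if "(a, b) \<in> set (zip L bs)" "sum_list bs < b'" "b' \<le> T" for a b b' L bs
    using set_zip_rightD[OF that(1)] member_le_sum_list[of b bs] that by simp
  then have "set M \<subseteq> ds_items (budget T D) \<and> length M \<le> 2"
    if "a \<in> ds_items D" "b \<le> T" "M \<in> ds_rules (budget T D) (a, b) \<sigma>" for a b M \<sigma>
  proof -
    from that(3) obtain L bs where L: "M = zip L bs" "L \<in> ds_rules D a \<sigma>" "length bs = length L"
      "sum_list bs < b" by auto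
    have "v \<in> ds_items (budget T D)" if "v \<in> set M" for v
    proof -
      obtain a' b' where v: "v = (a', b')" by force
      have "set L \<subseteq> ds_items D" using assms L(2) \<open>a \<in> ds_items D\<close> by (simp add: ds_wf_def)
      moreover have "a' \<in> set L" using that v L(1) set_zip_leftD by fast
      moreover have "b' \<le> T" using le[of a' b' L bs b] that v L(1,4) \<open>b \<le> T\<close> by simp
      ultimately show ?thesis using v by auto
    qed
    moreover have "length M \<le> 2" using assms L \<open>a \<in> ds_items D\<close> by (simp add: ds_wf_def)
    ultimately show ?thesis by blast
  qed
  then show ?thesis using assms unfolding ds_wf_def by auto
qed

lemma budget_weight:
  "L \<in> ds_rules (budget T D) v \<sigma> \<Longrightarrow> sum_list (map snd L) < snd v"
  by (cases v) auto

text \<open>Each goal gets one unit more than its premises together, that is, the size of its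
  derivation tree.\<close>

lemma run_budget:
  "run D x h k s \<Longrightarrow> \<exists>bs. length bs = length s \<and> sum_list bs \<le> k \<and> run (budget T D) x h k (zip s bs)"
proof (induction rule: run.induct)
  case (run_Nil k)
  show ?case by (auto intro: run.run_Nil)
next
  case (run_Cons L a s k)
  then obtain bs where bs: "length bs = length L + length s" "sum_list bs \<le> k"
    "run (budget T D) x h k (zip (L @ s) bs)" by auto
  define bs1 bs2 where "bs1 = take (length L) bs" and "bs2 = drop (length L) bs"
  have b: "bs = bs1 @ bs2" "length bs1 = length L" "length bs2 = length s"
    using bs(1) by (auto simp: bs1_def bs2_def)
  have "run (budget T D) x h (Suc k) ((a, Suc (sum_list bs1)) # zip s bs2)"
    by (rule run.run_Cons[of "zip L bs1"]) (use run_Cons(1,2) bs b in auto)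
  then show ?case using b bs(2)
    by (intro exI[of _ "Suc (sum_list bs1) # bs2"]) auto
qed

lemma run_of_budget: "run (budget T D) x h k s \<Longrightarrow> run D x h k (map fst s)"
proof (induction rule: run.induct)
  case (run_Cons L v s k)
  obtain a b where v: "v = (a, b)" by force
  with run_Cons(1) have "map fst L \<in> active D x a" by auto
  then show ?case using run_Cons v by (auto intro!: run.run_Cons[of "map fst L"])
qed (simp add: run_Nil)

lemma der_budgetI:
  assumes "run D x h k [ds_root D]" "k \<le> T"
  shows "der (budget T D) x (ds_root (budget T D))"
  using assms(1)
proof cases
  case (run_Cons L k')
  with run_budget obtain bs where bs: "length bs = length L" "sum_list bs \<le> k'"
      "run (budget T D) x h k' (zip L bs)" by fastforce
  then have "zip L bs \<in> active (budget T D) x (ds_root (budget T D))"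
    using run_Cons assms(2) by (auto intro!: exI[of _ L] exI[of _ bs])
  then show ?thesis using run_imp_der[OF bs(3)] by (subst der_iff) blast
qed

lemma der_budgetD:
  "der (budget T D) x (ds_root (budget T D)) \<Longrightarrow> der D x (ds_root D)"
  using run_of_budget[of T D x _ _ "[(ds_root D, T)]"] by (auto simp: der_def)


section \<open>Automata as derivation systems\<close>

lemma sym_at_eq: "i \<le> Suc (length x) \<Longrightarrow> sym_at x i = tape x ! i"
  by (cases i) (auto simp: sym_at_def tape_def nth_append)

lemma tape_Left_End: "i \<le> Suc (length x) \<Longrightarrow> tape x ! i = Left_End \<longleftrightarrow> i = 0"
  by (cases i) (auto simp: tape_def nth_append)

lemma tape_Right_End: "i \<le> Suc (length x) \<Longrightarrow> tape x ! i = Right_End \<longleftrightarrow> i = Suc (length x)"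
  by (cases i) (auto simp: tape_def nth_append)

lemma allowed_moves_range:
  assumes "d \<in> allowed_moves (tape x ! i)" "i \<le> Suc (length x)" "int j = int i + d"
  shows "j \<le> Suc (length x)"
  using assms tape_Right_End[of i x]
  by (cases "tape x ! i") (auto simp: allowed_moves_def)

text \<open>Infinite paths count for neither condition, so the two are exact opposites. A machine
  that inverts acceptance on promised inputs therefore solves the swapped problem.\<close>

lemma some_path_accepts_iff: "some_path_accepts step acc c \<longleftrightarrow> \<not> all_halting_paths_reject step acc c"
  by (auto simp: some_path_accepts_def all_halting_paths_reject_def)

text \<open>Derivability of \<open>(q, i)\<close> stands for reachability of an accepting state.
  \<open>Suc B\<close> is the place of the right endmarker of an input of length
  \<open>B\<close>.\<close>

definition nfa_sys :: "nat \<Rightarrow> ('s, 'a) nfa2 \<Rightarrow> ('s \<times> nat, 'a) dsys" where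
  "nfa_sys B M = \<lparr>ds_items = nfa_states M \<times> {..Suc B}, ds_pos = snd,
     ds_rules = (\<lambda>(q, i) \<sigma>. if q \<in> nfa_acc M then {[]} else if q \<in> nfa_rej M then {}
       else {[(p, j)] | p j d. (p, d) \<in> nfa_delta M q \<sigma> \<and> int j = int i + d \<and> j \<le> Suc B}),
     ds_root = (nfa_init M, 0)\<rparr>"

lemma nfa_delta_closed:
  assumes "nfa_wf M" "q \<in> nfa_states M" "q \<notin> nfa_halting M" "(p, d) \<in> nfa_delta M q \<sigma>"
  shows "p \<in> nfa_states M \<and> d \<in> allowed_moves \<sigma>"
  using assms unfolding nfa_wf_def by blast

lemma wf_nfa_sys:
  assumes wf: "nfa_wf M"
  shows "ds_wf (Suc B) (nfa_sys B M)"
proof -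
  have "set L \<subseteq> ds_items (nfa_sys B M) \<and> length L \<le> 2"
    if "q \<in> nfa_states M" "L \<in> ds_rules (nfa_sys B M) (q, i) \<sigma>" for q i L \<sigma>
    using that nfa_delta_closed[OF wf that(1)]
    by (auto simp: nfa_sys_def nfa_halting_def split: if_splits)
  then show ?thesis using wf unfolding ds_wf_def nfa_wf_def by (auto simp: nfa_sys_def)
qed

lemma nfa_sys_linear: "L \<in> ds_rules (nfa_sys B M) v \<sigma> \<Longrightarrow> length L \<le> 1"
  by (cases v) (auto simp: nfa_sys_def split: if_splits)

lemma nfa_some_path_accepts_iff:
  "some_path_accepts (nfa_step M x) (nfa_accepting M) c \<longleftrightarrow>
     (\<exists>c'. (nfa_step M x)\<^sup>*\<^sup>* c c' \<and> nfa_accepting M c')"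
proof -
  have "halted (nfa_step M x) c" if "nfa_accepting M c" for c
    using that by (auto simp: halted_def nfa_accepting_def nfa_halting_def elim: nfa_step.cases)
  then show ?thesis unfolding some_path_accepts_def by blast
qed

text \<open>Both inductions carry the invariant that the head is on the tape, where
  \<open>sym_at\<close> agrees with the symbol that is read.\<close>

lemma der_nfa_sys:
  assumes wf: "nfa_wf M" and x: "length x \<le> B"
  shows "der (nfa_sys B M) x (ds_root (nfa_sys B M)) \<longleftrightarrow>
    some_path_accepts (nfa_step M x) (nfa_accepting M) (nfa_initial M)"
proof
  have "(\<exists>c. (nfa_step M x)\<^sup>*\<^sup>* v c \<and> nfa_accepting M c)"
    if "der (nfa_sys B M) x v" "fst v \<in> nfa_states M" "snd v \<le> Suc (length x)" for v
    using that
  proof (induction rule: der_induct)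
    case (rule v L)
    obtain q i where v: "v = (q, i)" by force
    show ?case
    proof (cases "q \<in> nfa_acc M")
      case False
      with rule v obtain p j d where L: "L = [(p, j)]" and q: "q \<notin> nfa_halting M"
        and d: "(p, d) \<in> nfa_delta M q (tape x ! i)" "int j = int i + d"
        using sym_at_eq[of i x]
        by (auto simp: nfa_sys_def nfa_halting_def split: if_splits)
      have c: "p \<in> nfa_states M" "j \<le> Suc (length x)"
        using nfa_delta_closed[OF wf _ q d(1)] allowed_moves_range[of d x i j] d rule.prems v by auto
      have "nfa_step M x v (p, j)" unfolding v by (rule nfa_step.intros[OF q d])
      then show ?thesis using rule.IH[of "(p, j)"] c L
        by (auto intro: converse_rtranclp_into_rtranclp)
    qed (auto simp: v nfa_accepting_def)
  qed
  from this[of "ds_root (nfa_sys B M)"]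
  show "some_path_accepts (nfa_step M x) (nfa_accepting M) (nfa_initial M)"
    if "der (nfa_sys B M) x (ds_root (nfa_sys B M))"
    using that wf unfolding nfa_some_path_accepts_iff
    by (auto simp: nfa_sys_def nfa_initial_def nfa_wf_def)
next
  have "der (nfa_sys B M) x v"
    if "(nfa_step M x)\<^sup>*\<^sup>* v c" "nfa_accepting M c" "fst v \<in> nfa_states M" "snd v \<le> Suc (length x)" for v c
    using that
  proof (induction rule: converse_rtranclp_induct)
    case base
    then show ?case by (cases c, subst der_iff) (auto simp: nfa_sys_def nfa_accepting_def)
  next
    case (step v v')
    from step(1) obtain q i p d j where v: "v = (q, i)" "v' = (p, j)" and q: "q \<notin> nfa_halting M"
      and d: "(p, d) \<in> nfa_delta M q (tape x ! i)" "int j = int i + d"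
      by (auto elim: nfa_step.cases)
    have c: "p \<in> nfa_states M" "j \<le> Suc (length x)"
      using nfa_delta_closed[OF wf _ q d(1)] allowed_moves_range[of d x i j] d step.prems v by auto
    then have "der (nfa_sys B M) x v'" using step v by auto
    moreover have "[v'] \<in> active (nfa_sys B M) x v"
      using v q d c x step.prems sym_at_eq[of i x] by (auto simp: nfa_sys_def nfa_halting_def)
    ultimately show ?case by (subst der_iff) force
  qed
  then show "der (nfa_sys B M) x (ds_root (nfa_sys B M))"
    if "some_path_accepts (nfa_step M x) (nfa_accepting M) (nfa_initial M)"
    using that wf unfolding nfa_some_path_accepts_iff
    by (auto simp: nfa_sys_def nfa_initial_def nfa_wf_def)
qed

section \<open>Pushdown automata: popping a word as a derivable item\<close>

lemma run_rule: "L \<in> active D x a \<Longrightarrow> run D x h k L \<Longrightarrow> \<exists>h. run D x h (Suc k) [a]"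
  using run_Cons[of L D a x "[]" "h + length L" k] run_mono[of D x h k L "h + length L" k] by auto

lemma run_pair: "run D x h k [a] \<Longrightarrow> run D x h' k' [b] \<Longrightarrow> \<exists>h. run D x h (k + k') [a, b]"
  using run_append[of D x h k "[a]" "Suc h + h'" k' "[b]"] run_mono[of D x h' k' "[b]" "Suc h + h'" k']
  by auto

lemma finite_tape_symbol: "finite (UNIV :: 'a::finite tape_symbol set)"
proof (rule finite_subset)
  show "UNIV \<subseteq> insert Left_End (insert Right_End (range (Sym :: 'a \<Rightarrow> _)))"
    by (auto simp: image_iff) (metis tape_symbol.exhaust)
qed simp

text \<open>All short words are taken, so that the set is closed under tails and
  \<open>pda_size\<close> accounts for it. The word of the root is added separately because
  \<open>push_size M\<close> may be 0.\<close>

definition pda_words :: "('s, 'g, 'a) npda2 \<Rightarrow> 'g list set" where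
  "pda_words M = insert [pda_bottom M] {w \<in> lists (pda_stack M). length w \<le> push_size M}"

text \<open>An item \<open>(q, i, w, Some (r, k))\<close> says that \<open>w\<close> can be popped on the way from state \<open>q\<close> at
  position \<open>i\<close> to state \<open>r\<close> at position \<open>k\<close>; an item \<open>(q, i, w, None)\<close> says that an accepting
  state can be reached.\<close>

type_synonym ('s, 'g) pda_item = "'s \<times> nat \<times> 'g list \<times> ('s \<times> nat) option"

text \<open>The two-premise rule guesses the state \<open>r\<close> and position \<open>k\<close> at
  which the pushed word \<open>u\<close> is used up and \<open>v\<close> becomes exposed. The
  one-premise rule covers acceptance before that moment, with \<open>v\<close> never
  touched.\<close>

fun pda_rules :: "nat \<Rightarrow> ('s, 'g, 'a) npda2 \<Rightarrow> ('s, 'g) pda_item \<Rightarrow> 'a tape_symbol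
    \<Rightarrow> ('s, 'g) pda_item list set" where
  "pda_rules B M (q, i, w, tgt) \<sigma> =
     (if tgt = None \<and> q \<in> pda_acc M then {[]} else {}) \<union>
     (case w of
        [] \<Rightarrow> if tgt = Some (q, i) then {[]} else {}
      | \<gamma> # v \<Rightarrow> if q \<in> pda_halting M then {} else
          {[(p, j, u, Some (r, k)), (r, k, v, tgt)] | p u d j r k. (p, u, d) \<in> pda_delta M q \<sigma> \<gamma> \<and>
             int j = int i + d \<and> j \<le> Suc B \<and> r \<in> pda_states M \<and> k \<le> Suc B} \<union>
          {[(p, j, u, None)] | p u d j. tgt = None \<and> (p, u, d) \<in> pda_delta M q \<sigma> \<gamma> \<and>
             int j = int i + d \<and> j \<le> Suc B})"

definition pda_sys :: "nat \<Rightarrow> ('s, 'g, 'a) npda2 \<Rightarrow> (('s, 'g) pda_item, 'a) dsys" where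
  "pda_sys B M = \<lparr>ds_items = pda_states M \<times> {..Suc B} \<times> pda_words M \<times>
       insert None (Some ` (pda_states M \<times> {..Suc B})),
     ds_pos = (\<lambda>(q, i, w, tgt). i), ds_rules = pda_rules B M,
     ds_root = (pda_init M, 0, [pda_bottom M], None)\<rparr>"

lemma pda_sys_simps [simp]:
  "ds_items (pda_sys B M) = pda_states M \<times> {..Suc B} \<times> pda_words M \<times>
       insert None (Some ` (pda_states M \<times> {..Suc B}))"
  "ds_pos (pda_sys B M) (q, i, w, tgt) = i" "ds_rules (pda_sys B M) = pda_rules B M"
  "ds_root (pda_sys B M) = (pda_init M, 0, [pda_bottom M], None)"
  by (simp_all add: pda_sys_def)

text \<open>The \<open>Max\<close> in \<open>push_size\<close> is informative only for finite sets;
  finiteness of the alphabet enters here.\<close>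

lemma finite_pushed_strings:
  fixes M :: "('s, 'g, 'a::finite) npda2"
  assumes "pda_wf M"
  shows "finite (pushed_strings M)"
proof (rule finite_subset)
  let ?T = "\<Union>q \<in> pda_states M - pda_halting M. \<Union>\<sigma>. \<Union>\<gamma> \<in> pda_stack M.
    (\<lambda>(p, w, d). w) ` pda_delta M q \<sigma> \<gamma>"
  show "pushed_strings M \<subseteq> ?T" unfolding pushed_strings_def by force
  show "finite ?T"
    using assms finite_tape_symbol[where 'a = 'a] unfolding pda_wf_def by (intro finite_UN_I finite_imageI) auto
qed

lemma pda_delta_closed:
  fixes M :: "('s, 'g, 'a::finite) npda2"
  assumes wf: "pda_wf M" and q: "q \<in> pda_states M" "q \<notin> pda_halting M" and g: "\<gamma> \<in> pda_stack M"
    and d: "(p, u, d) \<in> pda_delta M q \<sigma> \<gamma>"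
  shows "p \<in> pda_states M \<and> u \<in> lists (pda_stack M) \<and> length u \<le> push_size M \<and>
    d \<in> allowed_moves \<sigma>"
proof -
  have "u \<in> pushed_strings M" unfolding pushed_strings_def using q g d by blast
  then have "length u \<le> push_size M"
    unfolding push_size_def using finite_pushed_strings[OF wf] by (intro Max_ge) auto
  moreover have "pda_delta M q \<sigma> \<gamma> \<subseteq> pda_states M \<times> allowed_pushes M \<gamma> \<times> allowed_moves \<sigma>"
    using wf q g unfolding pda_wf_def by blast
  moreover have "allowed_pushes M \<gamma> \<subseteq> lists (pda_stack M)"
    using wf unfolding allowed_pushes_def pda_wf_def by (auto simp: Let_def)
  ultimately show ?thesis using d by auto
qed

lemma wf_pda_sys:
  fixes M :: "('s, 'g, 'a::finite) npda2"
  assumes wf: "pda_wf M"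
  shows "ds_wf (Suc B) (pda_sys B M)"
proof -
  have "finite {w \<in> lists (pda_stack M). length w \<le> push_size M}"
    using finite_lists_length_le[of "pda_stack M" "push_size M"] wf
    by (auto simp: pda_wf_def lists_eq_set)
  then have "finite (ds_items (pda_sys B M))"
    using wf by (auto simp: pda_words_def pda_wf_def)
  moreover have "set L \<subseteq> ds_items (pda_sys B M) \<and> length L \<le> 2"
    if v: "v \<in> ds_items (pda_sys B M)" and L: "L \<in> ds_rules (pda_sys B M) v \<sigma>" for v L \<sigma>
  proof -
    obtain q i w tgt where [simp]: "v = (q, i, w, tgt)" by (cases v)
    show ?thesis
    proof (cases w)
      case Nil
      then show ?thesis using L by (auto split: if_splits)
    next
      case (Cons \<gamma> t)
      then have w: "\<gamma> \<in> pda_stack M" "t \<in> pda_words M"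
        using v wf by (auto simp: pda_words_def pda_wf_def)
      have "p \<in> pda_states M \<and> u \<in> pda_words M"
        if "(p, u, d) \<in> pda_delta M q \<sigma> \<gamma>" "q \<notin> pda_halting M" for p u d
        using pda_delta_closed[OF wf _ that(2) w(1) that(1)] v by (auto simp: pda_words_def)
      then show ?thesis using L v Cons w by (fastforce split: if_splits)
    qed
  qed
  ultimately show ?thesis using wf unfolding ds_wf_def
    by (auto simp: pda_words_def pda_wf_def)
qed

definition pda_items :: "'n::comm_semiring_1 \<Rightarrow> 'n \<Rightarrow> 'n" where
  "pda_items s B = (s + s) * ((B + 1 + 1) * (1 + s * (B + 1 + 1)))"

text \<open>\<open>pda_words\<close> has at most one word more than the set counted in
  \<open>pda_size\<close>, so states times words are at most the size plus the number of states,
  hence at most twice the size. The other factors count positions and targets.\<close>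

lemma card_pda_sys:
  assumes wf: "pda_wf M"
  shows "card (ds_items (pda_sys B M)) \<le> pda_items (pda_size M) B"
proof -
  let ?W = "{w \<in> lists (pda_stack M). length w \<le> push_size M}" and ?Q = "card (pda_states M)"
  have fW: "finite ?W"
    using finite_lists_length_le[of "pda_stack M" "push_size M"] wf
    by (auto simp: pda_wf_def lists_eq_set)
  have "[] \<in> ?W" by simp
  with fW have "card ?W > 0" by (metis card_gt_0_iff empty_iff)
  then have Q: "?Q \<le> pda_size M" by (simp add: pda_size_def)
  have "card (pda_words M) \<le> card ?W + 1"
    unfolding pda_words_def using fW by (simp add: card_insert_if)
  then have "?Q * card (pda_words M) \<le> ?Q * (card ?W + 1)" by (rule mult_le_mono2)
  also have "\<dots> = pda_size M + ?Q" by (simp add: pda_size_def)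
  also note Q
  finally have QW: "?Q * card (pda_words M) \<le> pda_size M + pda_size M" by simp
  have I: "card (insert None (Some ` (pda_states M \<times> {..Suc B}))) \<le> 1 + ?Q * (B + 1 + 1)"
    using wf by (simp add: card_insert_if card_image card_cartesian_product pda_wf_def)
  have "card (ds_items (pda_sys B M)) = (?Q * card (pda_words M)) *
      ((B + 1 + 1) * card (insert None (Some ` (pda_states M \<times> {..Suc B}))))"
    by (simp only: pda_sys_simps card_cartesian_product card_atMost Suc_eq_plus1 mult_ac)
  also have "\<dots> \<le> (pda_size M + pda_size M) * ((B + 1 + 1) * (1 + pda_size M * (B + 1 + 1)))"
    using Q by (intro mult_le_mono QW order.refl order.trans[OF I] add_le_mono)
  finally show ?thesis by (simp only: pda_items_def)
qed

lemma pda_some_path_accepts_iff: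
  "some_path_accepts (pda_step M x) (pda_accepting M) c \<longleftrightarrow>
     (\<exists>c'. (pda_step M x)\<^sup>*\<^sup>* c c' \<and> pda_accepting M c')"
proof -
  have "halted (pda_step M x) c" if "pda_accepting M c" for c
    using that by (auto simp: halted_def pda_accepting_def pda_halting_def elim: pda_step.cases)
  then show ?thesis unfolding some_path_accepts_def by blast
qed

lemma pda_step_append: "pda_step M x (q, i, s) (p, j, t) \<Longrightarrow> pda_step M x (q, i, s @ r) (p, j, t @ r)"
  by (auto elim!: pda_step.cases intro!: pda_step.intros)

lemma pda_steps_append:
  "(pda_step M x)\<^sup>*\<^sup>* c c' \<Longrightarrow> (pda_step M x)\<^sup>*\<^sup>* (fst c, fst (snd c), snd (snd c) @ r)
    (fst c', fst (snd c'), snd (snd c') @ r)"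
proof (induction rule: rtranclp_induct)
  case (step y z)
  then show ?case using pda_step_append[of M x "fst y" "fst (snd y)" "snd (snd y)" "fst z" "fst (snd z)" "snd (snd z)"]
    by (simp add: rtranclp.rtrancl_into_rtrancl)
qed simp

text \<open>Until \<open>v\<close> lies exposed, the path does not depend on it; if this happens,
  the path can be cut there. The side condition on \<open>s'\<close> excludes the first case for
  paths that empty a nonempty \<open>v\<close>.\<close>

lemma pda_steps_split:
  "(pda_step M x ^^ k) (q, i, u @ v) (q', i', s') \<Longrightarrow>
    (\<exists>t. (pda_step M x ^^ k) (q, i, u) (q', i', t)) \<and> (v = [] \<or> s' \<noteq> []) \<or>
    (\<exists>k1 k2 r m. k1 + k2 = k \<and> (pda_step M x ^^ k1) (q, i, u) (r, m, []) \<and>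
       (pda_step M x ^^ k2) (r, m, v) (q', i', s'))"
proof (induction k arbitrary: q i u)
  case 0
  then show ?case by auto
next
  case (Suc k)
  show ?case
  proof (cases u)
    case Nil
    then show ?thesis using Suc.prems by (intro disjI2 exI[of _ 0] exI[of _ "Suc k"]) auto
  next
    case (Cons \<gamma> u')
    from relpowp_Suc_D2[OF Suc.prems] obtain c where
      c: "pda_step M x (q, i, u @ v) c" "(pda_step M x ^^ k) c (q', i', s')" by blast
    then obtain p w d j where st: "c = (p, j, w @ u' @ v)" "pda_step M x (q, i, u) (p, j, w @ u')"
      unfolding Cons by (auto elim!: pda_step.cases intro: pda_step.intros)
    have prepend: "(pda_step M x ^^ Suc k') (q, i, u) c" if "(pda_step M x ^^ k') (p, j, w @ u') c" for k' c
      by (rule relpowp_Suc_I2[of "pda_step M x", OF st(2) that])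
    from Suc.IH[of p j "w @ u'"] c(2) st(1)
    consider t where "(pda_step M x ^^ k) (p, j, w @ u') (q', i', t)" "v = [] \<or> s' \<noteq> []"
      | k1 k2 r m where "k1 + k2 = k" "(pda_step M x ^^ k1) (p, j, w @ u') (r, m, [])"
        "(pda_step M x ^^ k2) (r, m, v) (q', i', s')" by auto
    then show ?thesis
    proof cases
      case 1
      then show ?thesis using prepend by blast
    next
      case 2
      then show ?thesis using prepend[OF 2(2)] by (metis add_Suc)
    qed
  qed
qed

lemma pda_steps_pop:
  assumes "(pda_step M x ^^ k) (q, i, u @ v) (q', i', [])"
  shows "\<exists>k1 k2 r m. k1 + k2 = k \<and> (pda_step M x ^^ k1) (q, i, u) (r, m, []) \<and>
       (pda_step M x ^^ k2) (r, m, v) (q', i', [])"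
  using pda_steps_split[OF assms]
proof
  assume "(\<exists>t. (pda_step M x ^^ k) (q, i, u) (q', i', t)) \<and> (v = [] \<or> [] \<noteq> [])"
  \<comment> \<open>Here \<open>v = []\<close>, so the whole path pops \<open>u\<close> and the
    second part is empty.\<close>
  then show ?thesis using assms by (intro exI[of _ k] exI[of _ 0]) auto
qed

context
  fixes M :: "('s, 'g, 'a::finite) npda2" and x :: "'a list" and B :: nat
  assumes wf: "pda_wf M" and x: "length x \<le> B"
begin

definition pda_ok :: "('s, 'g) pda_config \<Rightarrow> bool" where
  "pda_ok c \<longleftrightarrow> (case c of (q, i, s) \<Rightarrow>
     q \<in> pda_states M \<and> i \<le> Suc (length x) \<and> s \<in> lists (pda_stack M))"

lemma pda_ok_step: "pda_step M x c c' \<Longrightarrow> pda_ok c \<Longrightarrow> pda_ok c'"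
proof (induction rule: pda_step.induct)
  case (1 q p w d i \<gamma> j s)
  then show ?case
    using pda_delta_closed[OF wf _ 1(1) _ 1(2)] allowed_moves_range[of d x i j]
    by (auto simp: pda_ok_def)
qed

lemma pda_ok_steps: "(pda_step M x)\<^sup>*\<^sup>* c c' \<Longrightarrow> pda_ok c \<Longrightarrow> pda_ok c'"
  by (induction rule: rtranclp_induct) (auto intro: pda_ok_step)

text \<open>A step sees only the top of the stack, so \<open>v\<close> can be put below a
  computation on \<open>u\<close>. The first premise comes first because its path shows that
  \<open>(r, k, v)\<close> satisfies \<open>pda_ok\<close>, as the second premise requires.\<close>

lemma der_pda_sys_sound:
  assumes "der (pda_sys B M) x (q, i, w, tgt)" "pda_ok (q, i, w)"
  shows "case tgt of Some (r, k) \<Rightarrow> (pda_step M x)\<^sup>*\<^sup>* (q, i, w) (r, k, [])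
    | None \<Rightarrow> \<exists>c. (pda_step M x)\<^sup>*\<^sup>* (q, i, w) c \<and> pda_accepting M c"
  using assms
proof (induction "(q, i, w, tgt)" arbitrary: q i w tgt rule: der_induct)
  case (rule L)
  have i: "sym_at x i = tape x ! i" using rule.prems sym_at_eq[of i x] by (auto simp: pda_ok_def)
  have acc: ?case if "tgt = None" "q \<in> pda_acc M"
    using that by (auto simp: pda_accepting_def)
  show ?case
  proof (cases w)
    case Nil
    then show ?thesis using rule(1) acc by (auto split: if_splits)
  next
    case (Cons \<gamma> v)
    show ?thesis
    proof (cases "tgt = None \<and> q \<in> pda_acc M")
      case False
      with rule(1) Cons i obtain p u d j where q: "q \<notin> pda_halting M"
        and d: "(p, u, d) \<in> pda_delta M q (tape x ! i) \<gamma>" "int j = int i + d"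
        and L: "(\<exists>r k. L = [(p, j, u, Some (r, k)), (r, k, v, tgt)]) \<or> L = [(p, j, u, None)] \<and> tgt = None"
        by (auto split: if_splits)
      have st: "pda_step M x (q, i, w) (p, j, u @ v)"
        unfolding Cons by (rule pda_step.intros[OF q d])
      have ok: "pda_ok (p, j, u)" "v \<in> lists (pda_stack M)"
        using pda_ok_step[OF st rule.prems] by (auto simp: pda_ok_def)
      from L show ?thesis
      proof (elim disjE exE conjE)
        fix r k assume L: "L = [(p, j, u, Some (r, k)), (r, k, v, tgt)]"
        then have 1: "(pda_step M x)\<^sup>*\<^sup>* (p, j, u) (r, k, [])"
          using rule(3)[of p j u "Some (r, k)"] ok by simp
        then have "pda_ok (r, k, v)" using pda_ok_steps[OF _ ok(1)] ok(2) by (auto simp: pda_ok_def)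
        then have 2: "case tgt of Some (r', k') \<Rightarrow> (pda_step M x)\<^sup>*\<^sup>* (r, k, v) (r', k', [])
            | None \<Rightarrow> \<exists>c. (pda_step M x)\<^sup>*\<^sup>* (r, k, v) c \<and> pda_accepting M c"
          using rule(3)[of r k v tgt] L by simp
        have "(pda_step M x)\<^sup>*\<^sup>* (q, i, w) (r, k, v)"
          using pda_steps_append[OF 1, of v] st by (auto intro: converse_rtranclp_into_rtranclp)
        with 2 show ?thesis by (auto split: option.splits intro: rtranclp_trans)
      next
        assume "L = [(p, j, u, None)]" and t: "tgt = None"
        then obtain c where c: "(pda_step M x)\<^sup>*\<^sup>* (p, j, u) c" "pda_accepting M c"
          using rule(3)[of p j u None] ok by auto
        from pda_steps_append[OF c(1), of v] st
        have "(pda_step M x)\<^sup>*\<^sup>* (q, i, w) (fst c, fst (snd c), snd (snd c) @ v)"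
          by (auto intro: converse_rtranclp_into_rtranclp)
        with c(2) show ?thesis unfolding t by (auto simp: pda_accepting_def)
      qed
    qed (use acc in auto)
  qed
qed

text \<open>\<open>2 * k + 1\<close> solves the recursion: one step leaves
  \<open>k1 + k2 = k - 1\<close> steps to two premises, and
  \<open>1 + (2 * k1 + 1) + (2 * k2 + 1) = 2 * k + 1\<close>. The induction is over all smaller
  \<open>k\<close> since the second premise starts somewhere along the path.\<close>

lemma run_pda_sys:
  assumes "(pda_step M x ^^ k) (q, i, w) (q', i', s)" "pda_ok (q, i, w)"
  shows "s = [] \<Longrightarrow> \<exists>h. run (pda_sys B M) x h (2 * k + 1) [(q, i, w, Some (q', i'))]"
    and "q' \<in> pda_acc M \<Longrightarrow> \<exists>h. run (pda_sys B M) x h (2 * k + 1) [(q, i, w, None)]"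
proof -
  let ?R = "\<lambda>k a. \<exists>h. run (pda_sys B M) x h (2 * k + 1) [a]"
  have nil: "?R k (q, i, w, tgt)" if "[] \<in> pda_rules B M (q, i, w, tgt) (sym_at x i)" for k q i w tgt
  proof -
    have "run (pda_sys B M) x 0 (Suc (2 * k)) [(q, i, w, tgt)]"
      by (rule run_Cons[of "[]"]) (use that in \<open>simp_all add: run_Nil del: pda_rules.simps\<close>)
    then show ?thesis by auto
  qed
  have "(s = [] \<longrightarrow> ?R k (q, i, w, Some (q', i'))) \<and> (q' \<in> pda_acc M \<longrightarrow> ?R k (q, i, w, None))"
    using assms
  proof (induction k arbitrary: q i w q' i' s rule: less_induct)
    case (less k)
    show ?case
    proof (cases k)
      case 0
      with less.prems have "q' = q" "i' = i" "w = s" by auto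
      then show ?thesis using nil[of q i w "Some (q, i)" k] nil[of q i w None k] by auto
    next
      case (Suc k')
      with relpowp_Suc_D2 less.prems(1) obtain c where
        c: "pda_step M x (q, i, w) c" "(pda_step M x ^^ k') c (q', i', s)" by metis
      then obtain \<gamma> v p u d j where w: "w = \<gamma> # v" "c = (p, j, u @ v)" and q: "q \<notin> pda_halting M"
        and d: "(p, u, d) \<in> pda_delta M q (tape x ! i) \<gamma>" "int j = int i + d"
        by (auto elim: pda_step.cases)
      have okc: "pda_ok (p, j, u @ v)" using pda_ok_step[OF c(1) less.prems(2)] w by simp
      then have ok: "pda_ok (p, j, u)" "v \<in> lists (pda_stack M)" "j \<le> Suc B"
        using x by (auto simp: pda_ok_def)
      have i: "sym_at x i = tape x ! i" using less.prems sym_at_eq[of i x] by (auto simp: pda_ok_def)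
      have pair: "?R k (q, i, w, tgt)"
        if k: "k1 + k2 = k'" "?R k1 (p, j, u, Some (r, m))" "?R k2 (r, m, v, tgt)" "pda_ok (r, m, v)"
        for k1 k2 r m tgt
      proof -
        from k(2,3) obtain h1 h2 where "run (pda_sys B M) x h1 (2 * k1 + 1) [(p, j, u, Some (r, m))]"
          "run (pda_sys B M) x h2 (2 * k2 + 1) [(r, m, v, tgt)]" by (elim exE)
        from run_pair[OF this] obtain h where h: "run (pda_sys B M) x h (2 * k1 + 1 + (2 * k2 + 1))
            [(p, j, u, Some (r, m)), (r, m, v, tgt)]" ..
        have "[(p, j, u, Some (r, m)), (r, m, v, tgt)] \<in> active (pda_sys B M) x (q, i, w, tgt)"
          using w q d ok i k(4) x by (auto simp: pda_ok_def)
        from run_rule[OF this h] show ?thesis using k(1) Suc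
          by (auto simp: algebra_simps)
      qed
      have split: "?R k (q, i, w, tgt)"
        if k: "k1 + k2 = k'" "(pda_step M x ^^ k1) (p, j, u) (r, m, [])"
          "pda_ok (r, m, v) \<Longrightarrow> ?R k2 (r, m, v, tgt)" for k1 k2 r m tgt
      proof -
        have "(pda_step M x)\<^sup>*\<^sup>* (p, j, u) (r, m, [])" using k(2) relpowp_imp_rtranclp by fastforce
        then have "pda_ok (r, m, [])" using pda_ok_steps ok(1) by blast
        then have okr: "pda_ok (r, m, v)" using ok(2) by (auto simp: pda_ok_def)
        have "k1 < k" using k(1) Suc by simp
        then have "?R k1 (p, j, u, Some (r, m))" using less.IH[OF _ k(2) ok(1)] by blast
        from pair[OF k(1) this k(3)[OF okr] okr] show ?thesis .
      qed
      have "?R k (q, i, w, Some (q', i'))" if s: "s = []"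
      proof -
        from pda_steps_pop c(2) s obtain k1 k2 r m where k: "k1 + k2 = k'"
          "(pda_step M x ^^ k1) (p, j, u) (r, m, [])" "(pda_step M x ^^ k2) (r, m, v) (q', i', [])"
          unfolding w(2) by metis
        then have "k2 < k" using Suc by simp
        then have "?R k2 (r, m, v, Some (q', i'))" if "pda_ok (r, m, v)"
          using less.IH[OF _ k(3) that] by blast
        from split[OF k(1,2) this] show ?thesis .
      qed
      moreover have "?R k (q, i, w, None)" if a: "q' \<in> pda_acc M"
      proof -
        from pda_steps_split[OF c(2)[unfolded w(2)]]
        consider t where "(pda_step M x ^^ k') (p, j, u) (q', i', t)"
          | k1 k2 r m where "k1 + k2 = k'" "(pda_step M x ^^ k1) (p, j, u) (r, m, [])"
            "(pda_step M x ^^ k2) (r, m, v) (q', i', s)" by blast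
        then show ?thesis
        proof cases
          case 1
          have "k' < k" using Suc by simp
          then obtain h where h: "run (pda_sys B M) x h (2 * k' + 1) [(p, j, u, None)]"
            using less.IH[OF _ 1 ok(1)] a by blast
          have "[(p, j, u, None)] \<in> active (pda_sys B M) x (q, i, w, None)"
            using w q d ok i by auto
          from run_rule[OF this h] obtain h where "run (pda_sys B M) x h (Suc (2 * k' + 1)) [(q, i, w, None)]" ..
          then have "run (pda_sys B M) x h (2 * k + 1) [(q, i, w, None)]"
            by (rule run_mono) (use Suc in auto)
          then show ?thesis ..
        next
          case 2
          then have "k2 < k" using Suc by simp
          then have "?R k2 (r, m, v, None)" if "pda_ok (r, m, v)"
            using less.IH[OF _ 2(3) that] a by blast
          from split[OF 2(1,2) this] show ?thesis .
        qed
      qed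
      ultimately show ?thesis by blast
    qed
  qed
  then show "s = [] \<Longrightarrow> \<exists>h. run (pda_sys B M) x h (2 * k + 1) [(q, i, w, Some (q', i'))]"
    and "q' \<in> pda_acc M \<Longrightarrow> \<exists>h. run (pda_sys B M) x h (2 * k + 1) [(q, i, w, None)]"
    by blast+
qed

lemma pda_ok_initial: "pda_ok (pda_initial M)"
  using wf by (auto simp: pda_ok_def pda_initial_def pda_wf_def)

lemma der_pda_sysD:
  "der (pda_sys B M) x (ds_root (pda_sys B M)) \<Longrightarrow>
    some_path_accepts (pda_step M x) (pda_accepting M) (pda_initial M)"
  using der_pda_sys_sound[of "pda_init M" 0 "[pda_bottom M]" None] pda_ok_initial
  unfolding pda_some_path_accepts_iff by (simp add: pda_initial_def)

lemma run_pda_sysI: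
  assumes "(pda_step M x ^^ k) (pda_initial M) c" "pda_accepting M c"
  shows "\<exists>h. run (pda_sys B M) x h (2 * k + 1) [ds_root (pda_sys B M)]"
  using run_pda_sys(2)[of k "pda_init M" 0 "[pda_bottom M]" "fst c" "fst (snd c)" "snd (snd c)"]
    assms pda_ok_initial by (simp add: pda_initial_def pda_accepting_def)

end


section \<open>Derivation systems as automata\<close>

lemma ds_wf_rules:
  "ds_wf B D \<Longrightarrow> a \<in> ds_items D \<Longrightarrow> L \<in> ds_rules D a \<sigma> \<Longrightarrow> set L \<subseteq> ds_items D"
  "ds_wf B D \<Longrightarrow> a \<in> ds_items D \<Longrightarrow> L \<in> ds_rules D a \<sigma> \<Longrightarrow> length L \<le> 2"
  "ds_wf B D \<Longrightarrow> a \<in> ds_items D \<Longrightarrow> ds_pos D a \<le> B"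
  by (simp_all add: ds_wf_def)

text \<open>Positions range up to a uniform bound while inputs may be shorter, so a goal may lie
  beyond the tape. The walk then stops at the endmarker, which is the symbol that
  \<open>sym_at\<close> prescribes out there.\<close>

definition at_goal :: "'a tape_symbol \<Rightarrow> nat \<Rightarrow> nat \<Rightarrow> bool" where
  "at_goal \<sigma> p t \<longleftrightarrow> p = t \<or> p < t \<and> \<sigma> = Right_End"

text \<open>A walk pushes its goal back, so each move has the shape of a pushdown transition. The
  machine must remember \<open>p\<close>, as the tape shows only a symbol.\<close>

definition move :: "('i, 'a) dsys \<Rightarrow> 'a tape_symbol \<Rightarrow> nat \<Rightarrow> 'i \<Rightarrow> (nat \<times> 'i list \<times> int) set" where
  "move D \<sigma> p a = {(p, L, 0) | L. at_goal \<sigma> p (ds_pos D a) \<and> L \<in> ds_rules D a \<sigma>} \<union>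
     (if p < ds_pos D a \<and> \<sigma> \<noteq> Right_End then {(Suc p, [a], 1)} else {}) \<union>
     (if ds_pos D a < p \<and> \<sigma> \<noteq> Left_End then {(p - 1, [a], -1)} else {})"

text \<open>Common abstraction of both target machines: for fixed \<open>h\<close> it fits into the
  states of a 2nfa, for any \<open>h\<close> onto the stack of a 2npda.\<close>

inductive mstep :: "('i, 'a) dsys \<Rightarrow> 'a list \<Rightarrow> nat \<Rightarrow> nat \<times> 'i list \<Rightarrow> nat \<times> 'i list \<Rightarrow> bool"
  for D x h where
  "(p', w, d) \<in> move D (tape x ! p) p a \<Longrightarrow> length (w @ s) \<le> h
    \<Longrightarrow> mstep D x h (p, a # s) (p', w @ s)"

lemma move_int: "(p', w, d) \<in> move D \<sigma> p a \<Longrightarrow> int p' = int p + d"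
  by (auto simp: move_def split: if_splits)

lemma move_allowed: "(p', w, d) \<in> move D \<sigma> p a \<Longrightarrow> d \<in> allowed_moves \<sigma>"
  by (cases \<sigma>) (auto simp: move_def allowed_moves_def split: if_splits)

lemma move_bound: "(p', w, d) \<in> move D \<sigma> p a \<Longrightarrow> p \<le> B \<Longrightarrow> ds_pos D a \<le> B \<Longrightarrow> p' \<le> B"
  by (auto simp: move_def split: if_splits)

lemma move_word: "(p', w, d) \<in> move D \<sigma> p a \<Longrightarrow> w = [a] \<or> w \<in> ds_rules D a \<sigma>"
  by (auto simp: move_def split: if_splits)

lemma at_goal_sym_at: "at_goal (tape x ! p) p t \<Longrightarrow> p \<le> Suc (length x) \<Longrightarrow> tape x ! p = sym_at x t"
  using tape_Right_End[of p x] sym_at_eq[of p x] by (auto simp: at_goal_def sym_at_def)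

lemma move_active:
  assumes "(p', w, d) \<in> move D (tape x ! p) p a" "p \<le> Suc (length x)"
  shows "(w = [a] \<or> w \<in> active D x a) \<and> p' \<le> Suc (length x)"
  using assms allowed_moves_range[OF move_allowed[OF assms(1)] assms(2) move_int[OF assms(1)]]
    at_goal_sym_at[OF _ assms(2)]
  by (auto simp: move_def split: if_splits)

lemma move_der:
  assumes "(p', w, d) \<in> move D (tape x ! p) p a" "p \<le> Suc (length x)" "\<forall>b \<in> set w. der D x b"
  shows "der D x a"
  using move_active[OF assms(1,2)] assms(3) by (auto intro: der_iff[THEN iffD2])

lemma mstep_walk:
  assumes "p \<le> Suc (length x)" "p \<le> B" "ds_pos D a \<le> B" "length (a # s) \<le> h"
  shows "\<exists>n p'. n \<le> B \<and> (mstep D x h ^^ n) (p, a # s) (p', a # s) \<and> p' \<le> Suc (length x) \<and> p' \<le> B \<and>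
    at_goal (tape x ! p') p' (ds_pos D a)"
proof -
  let ?t = "ds_pos D a"
  have "\<exists>n p'. n \<le> ?t - p + (p - ?t) \<and> (mstep D x h ^^ n) (p, a # s) (p', a # s) \<and>
    p' \<le> Suc (length x) \<and> p' \<le> B \<and> at_goal (tape x ! p') p' ?t"
    using assms(1,2)
  proof (induction "?t - p + (p - ?t)" arbitrary: p)
    case 0
    then show ?case by (intro exI[of _ 0] exI[of _ p]) (auto simp: at_goal_def)
  next
    case (Suc m)
    show ?case
    proof (cases "at_goal (tape x ! p) p ?t")
      case True
      then show ?thesis using Suc.prems by (intro exI[of _ 0] exI[of _ p]) auto
    next
      case False
      have "\<exists>p'. mstep D x h (p, a # s) (p', a # s) \<and> m = ?t - p' + (p' - ?t) \<and>
        p' \<le> Suc (length x) \<and> p' \<le> B"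
      proof (cases "p < ?t")
        case True
        with False have R: "tape x ! p \<noteq> Right_End" by (auto simp: at_goal_def)
        then have "(Suc p, [a], 1) \<in> move D (tape x ! p) p a" using True by (simp add: move_def)
        from mstep.intros[OF this, of s h] show ?thesis
          using True R Suc.prems Suc.hyps(2) tape_Right_End[of p x] assms(3,4)
          by (intro exI[of _ "Suc p"]) auto
      next
        case F: False
        with False have lt: "?t < p" by (auto simp: at_goal_def)
        then have "(p - 1, [a], -1) \<in> move D (tape x ! p) p a"
          using tape_Left_End[OF Suc.prems(1)] by (simp add: move_def)
        from mstep.intros[OF this, of s h] show ?thesis
          using lt Suc.prems Suc.hyps(2) assms(4) by (intro exI[of _ "p - 1"]) auto
      qed
      then obtain p' where p': "mstep D x h (p, a # s) (p', a # s)" "m = ?t - p' + (p' - ?t)"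
        "p' \<le> Suc (length x)" "p' \<le> B" by blast
      from Suc.hyps(1)[OF p'(2-4)] obtain n q where nq: "n \<le> m" "(mstep D x h ^^ n) (p', a # s) (q, a # s)"
        "q \<le> Suc (length x)" "q \<le> B" "at_goal (tape x ! q) q ?t" using p'(2) by auto
      then show ?thesis using relpowp_Suc_I2[of "mstep D x h", OF p'(1) nq(2)] Suc.hyps(2)
        by (intro exI[of _ "Suc n"] exI[of _ q]) auto
    qed
  qed
  moreover have "?t - p + (p - ?t) \<le> B" using assms by auto
  ultimately show ?thesis using order.trans by blast
qed

text \<open>A rule application costs at most \<open>B\<close> walking steps and one replacement,
  hence \<open>B + 1\<close>.\<close>

lemma run_mstep:
  assumes wf: "ds_wf B D"
  shows "run D x h k s \<Longrightarrow> p \<le> Suc (length x) \<Longrightarrow> p \<le> B \<Longrightarrow> length s \<le> h \<Longrightarrow> set s \<subseteq> ds_items D \<Longrightarrow>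
    \<exists>n p'. n \<le> k * (B + 1) \<and> p' \<le> B \<and> (mstep D x h ^^ n) (p, s) (p', [])"
proof (induction arbitrary: p rule: run.induct)
  case (run_Nil k)
  then show ?case by (intro exI[of _ 0] exI[of _ p]) auto
next
  case (run_Cons L a s k)
  have "a \<in> ds_items D" using run_Cons.prems(4) by simp
  then have a: "ds_pos D a \<le> B" "set L \<subseteq> ds_items D"
    using ds_wf_rules(3)[OF wf] ds_wf_rules(1)[OF wf _ run_Cons.hyps(1)] by blast+
  from mstep_walk[OF run_Cons.prems(1,2) a(1) run_Cons.prems(3)] obtain n p' where n: "n \<le> B"
    "(mstep D x h ^^ n) (p, a # s) (p', a # s)" "p' \<le> Suc (length x)" "p' \<le> B"
    "at_goal (tape x ! p') p' (ds_pos D a)" by blast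
  then have "(p', L, 0) \<in> move D (tape x ! p') p' a"
    using run_Cons(1) at_goal_sym_at[OF n(5,3)] by (simp add: move_def)
  from mstep.intros[OF this run_Cons(2)]
  have "(mstep D x h ^^ Suc n) (p, a # s) (p', L @ s)" using n(2) by auto
  moreover obtain n' p'' where n': "n' \<le> k * (B + 1)" "p'' \<le> B" "(mstep D x h ^^ n') (p', L @ s) (p'', [])"
    using run_Cons.IH[OF n(3,4)] run_Cons a by auto
  ultimately have "(mstep D x h ^^ (Suc n + n')) (p, a # s) (p'', [])"
    by (metis relpowp_trans)
  then show ?case using n n' by (intro exI[of _ "Suc n + n'"] exI[of _ p'']) auto
qed

text \<open>A state codes the whole goal stack and the head position; for constant \<open>h\<close>
  their number is polynomial. No state rejects, since a search that gets stuck already counts as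
  rejecting.\<close>

definition nfa_of :: "nat \<Rightarrow> nat \<Rightarrow> (nat, 'a) dsys \<Rightarrow> (nat, 'a) nfa2" where
  "nfa_of h B D = (let Q = to_nat ` ({s. set s \<subseteq> ds_items D \<and> length s \<le> h} \<times> {..B}) in
     \<lparr>nfa_states = Q,
      nfa_delta = (\<lambda>q \<sigma>. case from_nat q of
          ([], p) \<Rightarrow> {}
        | (a # s, p) \<Rightarrow> {(to_nat (w @ s, p'), d) | p' w d. (p', w, d) \<in> move D \<sigma> p a \<and> length (w @ s) \<le> h}),
      nfa_init = to_nat ([ds_root D], 0::nat),
      nfa_acc = {q \<in> Q. fst (from_nat q :: nat list \<times> nat) = []},
      nfa_rej = {}\<rparr>)"

lemma nfa_of_simps [simp]:
  "nfa_states (nfa_of h B D) = to_nat ` ({s. set s \<subseteq> ds_items D \<and> length s \<le> h} \<times> {..B})"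
  "nfa_delta (nfa_of h B D) (to_nat ([] :: nat list, p :: nat)) \<sigma> = {}"
  "nfa_delta (nfa_of h B D) (to_nat (a # s, p)) \<sigma> =
     {(to_nat (w @ s, p'), d) | p' w d. (p', w, d) \<in> move D \<sigma> p a \<and> length (w @ s) \<le> h}"
  "nfa_init (nfa_of h B D) = to_nat ([ds_root D], 0::nat)"
  "to_nat (s :: nat list, p :: nat) \<in> nfa_acc (nfa_of h B D) \<longleftrightarrow> s = [] \<and> p \<le> B"
  "nfa_rej (nfa_of h B D) = {}"
  by (auto simp: nfa_of_def Let_def)

lemma nfa_acc_of_subset: "nfa_acc (nfa_of h B D) \<subseteq> nfa_states (nfa_of h B D)"
  by (auto simp: nfa_of_def Let_def)

lemma wf_nfa_of:
  assumes wf: "ds_wf B D" and h: "1 \<le> h"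
  shows "nfa_wf (nfa_of h B D)"
proof -
  have "nfa_delta (nfa_of h B D) q \<sigma> \<subseteq> nfa_states (nfa_of h B D) \<times> allowed_moves \<sigma>"
    if "q \<in> nfa_states (nfa_of h B D)" for q \<sigma>
  proof -
    from that obtain s p where q: "q = to_nat (s, p)" "set s \<subseteq> ds_items D" "length s \<le> h" "p \<le> B"
      by auto
    show ?thesis
    proof (cases s)
      case (Cons a t)
      then have a: "a \<in> ds_items D" using q by simp
      have "p' \<le> B \<and> set w \<subseteq> ds_items D \<and> d \<in> allowed_moves \<sigma>" if "(p', w, d) \<in> move D \<sigma> p a" for p' w d
        using move_word[OF that] move_bound[OF that q(4)] move_allowed[OF that] ds_wf_rules[OF wf a] a
        by auto
      then show ?thesis using q Cons by auto
    qed (simp add: q)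
  qed
  moreover have "finite (nfa_states (nfa_of h B D))"
    using wf finite_lists_length_le[of "ds_items D" h] by (auto simp: ds_wf_def)
  ultimately show ?thesis
    using nfa_acc_of_subset[of h B D] wf h unfolding nfa_wf_def by (auto simp: ds_wf_def)
qed

lemma nfa_size_of:
  assumes wf: "ds_wf B D"
  shows "nfa_size (nfa_of h B D) \<le> (card (ds_items D) + 1) ^ h * (B + 1)"
proof -
  let ?S = "{s. set s \<subseteq> ds_items D \<and> length s \<le> h}"
  have f: "finite (ds_items D)" using wf by (simp add: ds_wf_def)
  have sum: "(\<Sum>i\<le>h. n ^ i) \<le> (n + 1) ^ h" for n :: nat
  proof (induction h)
    case (Suc h)
    have "n ^ Suc h \<le> n * (n + 1) ^ h" by (simp add: power_mono)
    with Suc have "(\<Sum>i\<le>h. n ^ i) + n ^ Suc h \<le> (n + 1) ^ h + n * (n + 1) ^ h" by (rule add_mono)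
    then show ?case by simp
  qed simp
  have "nfa_size (nfa_of h B D) \<le> card (?S \<times> {..B})"
    unfolding nfa_size_def nfa_of_simps by (rule card_image_le) (simp add: finite_lists_length_le f)
  also have "\<dots> \<le> (card (ds_items D) + 1) ^ h * (B + 1)"
    unfolding card_cartesian_product card_lists_length_le[OF f] card_atMost Suc_eq_plus1
    by (rule mult_le_mono1[OF sum])
  finally show ?thesis .
qed

text \<open>Read backwards from acceptance, every stack on the path consists of derivable
  goals.\<close>

lemma nfa_of_sound:
  assumes "(nfa_step (nfa_of h B D) x)\<^sup>*\<^sup>* c c'" "nfa_accepting (nfa_of h B D) c'"
    "c = (to_nat (s, p), p)" "p \<le> Suc (length x)" "a \<in> set s"
  shows "der D x a"
  using assms
proof (induction arbitrary: s p a rule: converse_rtranclp_induct)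
  case base
  then show ?case by (simp add: nfa_accepting_def)
next
  case (step c c'')
  from step(1) step.prems(2) obtain b t where s: "s = b # t"
    by (cases s) (auto elim!: nfa_step.cases)
  from step(1) step.prems(2) obtain p' w d j where m: "(p', w, d) \<in> move D (tape x ! p) p b"
    and "c'' = (to_nat (w @ t, p'), j)" "int j = int p + d"
    unfolding s by (auto elim!: nfa_step.cases)
  then have c'': "c'' = (to_nat (w @ t, p'), p')" using move_int[OF m] by simp
  have "der D x e" if "e \<in> set (w @ t)" for e
    using step.IH[OF step.prems(1) c'' _ that] move_active[OF m step.prems(3)] by blast
  then show ?case using move_der[OF m step.prems(3)] s step.prems(4) by auto
qed

lemma nfa_of_complete:
  "(mstep D x h ^^ n) (p, s) (p', s') \<Longrightarrow>
    (nfa_step (nfa_of h B D) x)\<^sup>*\<^sup>* (to_nat (s, p), p) (to_nat (s', p'), p')"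
proof (induction n arbitrary: p' s')
  case (Suc n)
  then obtain q t where 1: "(mstep D x h ^^ n) (p, s) (q, t)" "mstep D x h (q, t) (p', s')"
    by (auto elim: relpowp_Suc_E)
  from 1(2) obtain a w d r where m: "t = a # r" "s' = w @ r" "(p', w, d) \<in> move D (tape x ! q) q a"
      "length (w @ r) \<le> h"
    by (auto elim: mstep.cases)
  have "nfa_step (nfa_of h B D) x (to_nat (t, q), q) (to_nat (s', p'), p')"
    by (rule nfa_step.intros[where d = d])
      (use m move_int[OF m(3)] in \<open>auto simp: nfa_halting_def\<close>)
  with Suc.IH[OF 1(1)] show ?case by simp
qed simp

lemma nfa_of_accepts:
  assumes wf: "ds_wf B D" and h: "1 \<le> h"
  shows "some_path_accepts (nfa_step (nfa_of h B D) x) (nfa_accepting (nfa_of h B D))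
      (nfa_initial (nfa_of h B D)) \<Longrightarrow> der D x (ds_root D)"
    and "run D x h k [ds_root D] \<Longrightarrow> some_path_accepts (nfa_step (nfa_of h B D) x)
      (nfa_accepting (nfa_of h B D)) (nfa_initial (nfa_of h B D))"
proof -
  show "der D x (ds_root D)" if "some_path_accepts (nfa_step (nfa_of h B D) x)
      (nfa_accepting (nfa_of h B D)) (nfa_initial (nfa_of h B D))"
    using that nfa_of_sound[of h B D x _ _ "[ds_root D]" 0]
    unfolding nfa_some_path_accepts_iff by (auto simp: nfa_initial_def)
next
  assume "run D x h k [ds_root D]"
  from run_mstep[OF wf this, of 0] obtain n p' where
    "p' \<le> B" "(mstep D x h ^^ n) (0, [ds_root D]) (p', [])" using wf h by (auto simp: ds_wf_def)
  with nfa_of_complete[OF this(2), of B] show "some_path_accepts (nfa_step (nfa_of h B D) x)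
      (nfa_accepting (nfa_of h B D)) (nfa_initial (nfa_of h B D))"
    unfolding nfa_some_path_accepts_iff
    by (intro exI[of _ "(to_nat ([] :: nat list, p'), p')"]) (auto simp: nfa_initial_def nfa_accepting_def)
qed

section \<open>Depth-first search on the stack of a 2npda\<close>

datatype pda_state = Start | Accept | Run nat nat

instance pda_state :: countable
  by countable_datatype

text \<open>In \<open>Run p c\<close>, \<open>p\<close> is the head position and \<open>c\<close> is a clock. It is decreased by \<open>\<delta>\<close> in
  every step: for \<open>\<delta> = 1\<close> it enforces a time bound, for \<open>\<delta> = 0\<close> it is idle.\<close>

definition pda_of :: "nat \<Rightarrow> nat \<Rightarrow> nat \<Rightarrow> nat \<Rightarrow> (nat, 'a) dsys \<Rightarrow> (nat, nat, 'a) npda2" where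
  "pda_of \<delta> C B N D =
     \<lparr>pda_states = to_nat ` ({Start, Accept} \<union> (\<lambda>(p, c). Run p c) ` ({..B} \<times> {..C})),
      pda_stack = {..N},
      pda_delta = (\<lambda>q \<sigma> \<gamma>. case from_nat q of
          Start \<Rightarrow> if \<gamma> = N then {(to_nat (Run 0 C), [ds_root D, N], 0)} else {}
        | Accept \<Rightarrow> {}
        | Run p c \<Rightarrow> if \<gamma> = N then {(to_nat Accept, [N], 0)}
            else {(to_nat (Run p' c'), w, d) | p' c' w d. c = c' + \<delta> \<and> (p', w, d) \<in> move D \<sigma> p \<gamma>}),
      pda_init = to_nat Start,
      pda_bottom = N,
      pda_acc = {to_nat Accept},
      pda_rej = {}\<rparr>"

lemma pda_of_simps [simp]:
  "pda_states (pda_of \<delta> C B N D) = to_nat ` ({Start, Accept} \<union> (\<lambda>(p, c). Run p c) ` ({..B} \<times> {..C}))"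
  "pda_stack (pda_of \<delta> C B N D) = {..N}"
  "pda_delta (pda_of \<delta> C B N D) (to_nat Start) \<sigma> \<gamma> =
     (if \<gamma> = N then {(to_nat (Run 0 C), [ds_root D, N], 0)} else {})"
  "pda_delta (pda_of \<delta> C B N D) (to_nat Accept) \<sigma> \<gamma> = {}"
  "pda_delta (pda_of \<delta> C B N D) (to_nat (Run p c)) \<sigma> \<gamma> = (if \<gamma> = N then {(to_nat Accept, [N], 0)}
     else {(to_nat (Run p' c'), w, d) | p' c' w d. c = c' + \<delta> \<and> (p', w, d) \<in> move D \<sigma> p \<gamma>})"
  "pda_init (pda_of \<delta> C B N D) = to_nat Start"
  "pda_bottom (pda_of \<delta> C B N D) = N"
  "pda_acc (pda_of \<delta> C B N D) = {to_nat Accept}"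
  "pda_halting (pda_of \<delta> C B N D) = {to_nat Accept}"
  by (simp_all add: pda_of_def pda_halting_def)

context
  fixes D :: "(nat, 'a::finite) dsys" and B N :: nat
  assumes wf: "ds_wf B D" and items: "ds_items D = {..<N}"
begin

lemma root_less: "ds_root D < N"
  using wf items by (auto simp: ds_wf_def)

lemma move_closed:
  assumes "(p', w, d) \<in> move D \<sigma> p a" "a < N"
  shows "set w \<subseteq> {..<N} \<and> length w \<le> 2"
  using move_word[OF assms(1)] assms(2) ds_wf_rules[OF wf, of a] items by auto

text \<open>The bottom marker \<open>N\<close> lies just outside the item numbers, so no item
  collides with it. Push length 2 covers premise lists and the start word
  \<open>[ds_root D, N]\<close>.\<close>

lemma pda_delta_of:
  assumes q: "q \<in> pda_states (pda_of \<delta> C B N D)" and g: "\<gamma> \<le> N"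
    and t: "(r, w, d) \<in> pda_delta (pda_of \<delta> C B N D) q \<sigma> \<gamma>"
  shows "r \<in> pda_states (pda_of \<delta> C B N D) \<and> w \<in> allowed_pushes (pda_of \<delta> C B N D) \<gamma> \<and>
    d \<in> allowed_moves \<sigma> \<and> set w \<subseteq> {..N} \<and> length w \<le> 2 \<and> d \<in> {-1, 0, 1}"
proof -
  let ?M = "pda_of \<delta> C B N D"
  have zero: "0 \<in> allowed_moves \<sigma>" by (cases \<sigma>) (auto simp: allowed_moves_def)
  have pushN: "w @ [N] \<in> allowed_pushes ?M N" if "set w \<subseteq> {..<N}" for w
    using that by (auto simp: allowed_pushes_def Let_def)
  from q consider "q = to_nat Start" | "q = to_nat Accept"
    | p c where "q = to_nat (Run p c)" "p \<le> B" "c \<le> C" by auto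
  then show ?thesis
  proof cases
    case 1
    then show ?thesis using t zero pushN[of "[ds_root D]"] root_less by (auto split: if_splits)
  next
    case 2
    then show ?thesis using t by simp
  next
    case 3
    show ?thesis
    proof (cases "\<gamma> = N")
      case True
      then show ?thesis using t 3 zero pushN[of "[]"] by auto
    next
      case False
      then have "\<gamma> < N" using g by simp
      with t 3 False obtain p' c' where m: "r = to_nat (Run p' c')" "c = c' + \<delta>" "(p', w, d) \<in> move D \<sigma> p \<gamma>"
        by auto
      have "ds_pos D \<gamma> \<le> B" using ds_wf_rules(3)[OF wf, of \<gamma>] items \<open>\<gamma> < N\<close> by simp
      then have p': "p' \<le> B" by (rule move_bound[OF m(3) 3(2)])
      have d: "d \<in> allowed_moves \<sigma>" by (rule move_allowed[OF m(3)])
      have w: "set w \<subseteq> {..<N} \<and> length w \<le> 2" by (rule move_closed[OF m(3) \<open>\<gamma> < N\<close>])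
      then have "w \<in> allowed_pushes ?M \<gamma>" using False by (auto simp: allowed_pushes_def Let_def)
      moreover have "d \<in> {-1, 0, 1}" using d by (cases \<sigma>) (auto simp: allowed_moves_def)
      moreover have "Run p' c' \<in> (\<lambda>(p, c). Run p c) ` ({..B} \<times> {..C})"
        using p' m(2) 3(3) by (auto simp: image_iff)
      then have "r \<in> pda_states ?M" unfolding m(1) pda_of_simps by blast
      moreover have "set w \<subseteq> {..N}" using w by auto
      ultimately show ?thesis using d w by blast
    qed
  qed
qed

lemma wf_pda_of: "pda_wf (pda_of \<delta> C B N D)"
proof -
  let ?M = "pda_of \<delta> C B N D"
  have delta: "pda_delta ?M q \<sigma> \<gamma> \<subseteq> (pda_states ?M \<times> allowed_pushes ?M \<gamma> \<times> allowed_moves \<sigma>) \<inter>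
      (pda_states ?M \<times> {w. set w \<subseteq> {..N} \<and> length w \<le> 2} \<times> {-1, 0, 1})"
    if "q \<in> pda_states ?M" "\<gamma> \<in> pda_stack ?M" for q \<sigma> \<gamma>
  proof
    fix t assume t: "t \<in> pda_delta ?M q \<sigma> \<gamma>"
    obtain r w d where [simp]: "t = (r, w, d)" by (cases t)
    have "\<gamma> \<le> N" using that(2) by simp
    from pda_delta_of[OF that(1) this t[simplified]]
    show "t \<in> (pda_states ?M \<times> allowed_pushes ?M \<gamma> \<times> allowed_moves \<sigma>) \<inter>
      (pda_states ?M \<times> {w. set w \<subseteq> {..N} \<and> length w \<le> 2} \<times> {-1, 0, 1})"
      by (simp del: pda_of_simps)
  qed
  have "finite (pda_states ?M \<times> {w. set w \<subseteq> {..N} \<and> length w \<le> 2} \<times> {-1, 0, 1 :: int})"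
    using finite_lists_length_le[of "{..N}" 2] by simp
  with delta have "finite (pda_delta ?M q \<sigma> \<gamma>)"
    if "q \<in> pda_states ?M" "\<gamma> \<in> pda_stack ?M" for q \<sigma> \<gamma>
    using that by (meson finite_subset le_inf_iff)
  moreover have "pda_rej ?M = {}" by (simp add: pda_of_def)
  moreover have "pda_delta ?M q \<sigma> \<gamma> \<subseteq> pda_states ?M \<times> allowed_pushes ?M \<gamma> \<times> allowed_moves \<sigma>"
    if "q \<in> pda_states ?M" "\<gamma> \<in> pda_stack ?M" for q \<sigma> \<gamma>
    using delta[OF that] by (simp only: le_inf_iff)
  moreover have "finite (pda_states ?M)" "finite (pda_stack ?M)" "pda_init ?M \<in> pda_states ?M"
    "pda_bottom ?M \<in> pda_stack ?M" "pda_acc ?M \<subseteq> pda_states ?M" by auto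
  ultimately show ?thesis unfolding pda_wf_def by blast
qed

lemma pda_size_of:
  "pda_size (pda_of \<delta> C B N D) \<le> ((B + 1) * (C + 1) + 2) * ((N + 1) * (N + 1) + (N + 1) + 1)"
proof -
  let ?M = "pda_of \<delta> C B N D"
  have "length w \<le> 2" if w: "w \<in> pushed_strings ?M" for w
  proof -
    from w obtain q \<sigma> \<gamma> p d where "q \<in> pda_states ?M" "\<gamma> \<in> pda_stack ?M"
      "(p, w, d) \<in> pda_delta ?M q \<sigma> \<gamma>" unfolding pushed_strings_def by blast
    then show ?thesis using pda_delta_of[of q \<delta> C \<gamma> p w d \<sigma>] by simp
  qed
  then have "push_size ?M \<le> 2"
    unfolding push_size_def using finite_pushed_strings[OF wf_pda_of] by (intro Max.boundedI) auto
  then have "card {w \<in> lists (pda_stack ?M). length w \<le> push_size ?M} \<le> card (short_lists {..N})"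
    using finite_lists_length_le[of "{..N}" 2] by (intro card_mono) auto
  also have "\<dots> = (N + 1) * (N + 1) + (N + 1) + 1" by (subst card_short_lists) auto
  finally have 1: "card {w \<in> lists (pda_stack ?M). length w \<le> push_size ?M} \<le>
    (N + 1) * (N + 1) + (N + 1) + 1" .
  have "card (pda_states ?M) \<le> card ({Start, Accept} \<union> (\<lambda>(p, c). Run p c) ` ({..B} \<times> {..C}))"
    unfolding pda_of_simps by (rule card_image_le) auto
  also have "\<dots> \<le> card {Start, Accept} + card ((\<lambda>(p, c). Run p c) ` ({..B} \<times> {..C}))"
    by (rule card_Un_le)
  also have "\<dots> \<le> 2 + card ({..B} \<times> {..C})"
    by (intro add_mono card_image_le) auto
  finally have 2: "card (pda_states ?M) \<le> (B + 1) * (C + 1) + 2" by (simp add: card_cartesian_product)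
  show ?thesis unfolding pda_size_def by (rule mult_le_mono[OF 2 1])
qed

lemma pda_of_sound:
  assumes "(pda_step (pda_of \<delta> C B N D) x)\<^sup>*\<^sup>* c c'" "pda_accepting (pda_of \<delta> C B N D) c'"
    "c = (to_nat (Run p m), p, s @ [N])" "p \<le> Suc (length x)" "set s \<subseteq> {..<N}" "a \<in> set s"
  shows "der D x a"
  using assms
proof (induction arbitrary: s p m a rule: converse_rtranclp_induct)
  case base
  then show ?case by (simp add: pda_accepting_def)
next
  case (step c c'')
  from step.prems obtain b t where s: "s = b # t" "b < N" by (cases s) auto
  from step(1) step.prems(2) s(2) obtain p' m' w d j where m: "(p', w, d) \<in> move D (tape x ! p) p b"
    and "c'' = (to_nat (Run p' m'), j, (w @ t) @ [N])" "int j = int p + d"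
    unfolding s(1) by (auto elim!: pda_step.cases)
  then have c'': "c'' = (to_nat (Run p' m'), p', (w @ t) @ [N])" using move_int[OF m] by simp
  have "set (w @ t) \<subseteq> {..<N}" using move_closed[OF m s(2)] step.prems(4) s(1) by auto
  then have "der D x e" if "e \<in> set (w @ t)" for e
    using step.IH[OF step.prems(1) c'' _ _ that] move_active[OF m step.prems(3)] by blast
  then show ?case using move_der[OF m step.prems(3)] s step.prems(5) by auto
qed

lemma pda_of_complete:
  "(mstep D x h ^^ n) (p, s) (p', s') \<Longrightarrow> set s \<subseteq> {..<N} \<Longrightarrow> \<delta> * n \<le> m \<Longrightarrow>
    (pda_step (pda_of \<delta> C B N D) x)\<^sup>*\<^sup>* (to_nat (Run p m), p, s @ [N])
      (to_nat (Run p' (m - \<delta> * n)), p', s' @ [N]) \<and> set s' \<subseteq> {..<N}"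
proof (induction n arbitrary: p' s')
  case (Suc n)
  then obtain q t where 1: "(mstep D x h ^^ n) (p, s) (q, t)" "mstep D x h (q, t) (p', s')"
    by (auto elim: relpowp_Suc_E)
  from 1(2) obtain a w d r where m: "t = a # r" "s' = w @ r" "(p', w, d) \<in> move D (tape x ! q) q a"
    by (auto elim: mstep.cases)
  have IH: "(pda_step (pda_of \<delta> C B N D) x)\<^sup>*\<^sup>* (to_nat (Run p m), p, s @ [N])
      (to_nat (Run q (m - \<delta> * n)), q, t @ [N])" "set t \<subseteq> {..<N}"
    using Suc.IH[OF 1(1)] Suc.prems by auto
  have c: "m - \<delta> * n = (m - \<delta> * Suc n) + \<delta>" using Suc.prems(3) by simp
  have "pda_step (pda_of \<delta> C B N D) x (to_nat (Run q (m - \<delta> * n)), q, a # (r @ [N]))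
     (to_nat (Run p' (m - \<delta> * Suc n)), p', w @ (r @ [N]))"
    by (rule pda_step.intros[where d = d])
      (use m IH(2) c move_int[OF m(3)] in auto)
  with IH m show ?case using move_closed[OF m(3)] by (auto intro: rtranclp.rtrancl_into_rtrancl)
qed simp

text \<open>For \<open>\<delta> = 0\<close> the clock condition is trivial and searches of any
  length are simulated; for \<open>\<delta> = 1\<close> a run of \<open>k\<close> rules may need
  \<open>k * (B + 1)\<close> ticks.\<close>

lemma pda_of_accepts:
  shows "some_path_accepts (pda_step (pda_of \<delta> C B N D) x) (pda_accepting (pda_of \<delta> C B N D))
      (pda_initial (pda_of \<delta> C B N D)) \<Longrightarrow> der D x (ds_root D)"
    and "run D x h k [ds_root D] \<Longrightarrow> \<delta> * (k * (B + 1)) \<le> C \<Longrightarrow>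
      some_path_accepts (pda_step (pda_of \<delta> C B N D) x)
      (pda_accepting (pda_of \<delta> C B N D)) (pda_initial (pda_of \<delta> C B N D))"
proof -
  let ?M = "pda_of \<delta> C B N D"
  assume "some_path_accepts (pda_step ?M x) (pda_accepting ?M) (pda_initial ?M)"
  then obtain c where c: "(pda_step ?M x)\<^sup>*\<^sup>* (to_nat Start, 0, [N]) c" "pda_accepting ?M c"
    unfolding pda_some_path_accepts_iff by (auto simp: pda_initial_def)
  from c(1) show "der D x (ds_root D)"
  proof (cases rule: converse_rtranclpE)
    case base
    with c(2) show ?thesis by (auto simp: pda_accepting_def)
  next
    case (step c')
    from step(1) have "c' = (to_nat (Run 0 C), 0, [ds_root D] @ [N])"
      by (auto elim!: pda_step.cases)
    from pda_of_sound[OF step(2) c(2) this] show ?thesis using root_less by auto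
  qed
next
  let ?M = "pda_of \<delta> C B N D"
  assume r: "run D x h k [ds_root D]" and C: "\<delta> * (k * (B + 1)) \<le> C"
  \<comment> \<open>The run may have \<open>h = 0\<close>, but \<open>run_mstep\<close> needs room
    for the stack \<open>[ds_root D]\<close>.\<close>
  have "run D x (h + 1) k [ds_root D]" by (rule run_mono[OF r]) auto
  from run_mstep[OF wf this, of 0] obtain n p' where n: "n \<le> k * (B + 1)"
    "(mstep D x (h + 1) ^^ n) (0, [ds_root D]) (p', [])" using root_less items by auto
  then have "\<delta> * n \<le> C" using C mult_le_mono2[OF n(1), of \<delta>] by linarith
  with pda_of_complete[OF n(2)] root_less
  have "(pda_step ?M x)\<^sup>*\<^sup>* (to_nat (Run 0 C), 0, [ds_root D, N]) (to_nat (Run p' (C - \<delta> * n)), p', [N])"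
    by auto
  moreover have "pda_step ?M x (to_nat Start, 0, [N]) (to_nat (Run 0 C), 0, [ds_root D, N] @ [])"
    by (rule pda_step.intros[where d = 0]) auto
  moreover have "pda_step ?M x (to_nat (Run p' (C - \<delta> * n)), p', [N]) (to_nat Accept, p', [N] @ [])"
    by (rule pda_step.intros[where d = 0]) auto
  ultimately have "(pda_step ?M x)\<^sup>*\<^sup>* (pda_initial ?M) (to_nat Accept, p', [N])"
    by (auto simp: pda_initial_def intro: converse_rtranclp_into_rtranclp rtranclp.rtrancl_into_rtrancl)
  then show "some_path_accepts (pda_step ?M x) (pda_accepting ?M) (pda_initial ?M)"
    unfolding pda_some_path_accepts_iff by (auto simp: pda_accepting_def)
qed

text \<open>The potential \<open>\<phi>\<close> falls in each step, since a clock at 0 admits no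
  \<open>c'\<close> with \<open>0 = c' + 1\<close>. The extra 2 pays for leaving
  \<open>Start\<close> and entering \<open>Accept\<close>.\<close>

lemma pda_of_time: "all_paths_within (pda_step (pda_of 1 C B N D) x) (pda_initial (pda_of 1 C B N D)) (C + 2)"
proof -
  let ?M = "pda_of 1 C B N D"
  define \<phi> where "\<phi> c = (case from_nat (fst c) of Start \<Rightarrow> C + 2 | Accept \<Rightarrow> 0 | Run p m \<Rightarrow> m + 1)"
    for c :: "(nat, nat) pda_config"
  have dec: "\<phi> c' < \<phi> c \<and> fst c' \<in> range (to_nat :: pda_state \<Rightarrow> nat)"
    if "pda_step ?M x c c'" "fst c \<in> range (to_nat :: pda_state \<Rightarrow> nat)" for c c'
  proof -
    from that(2) obtain S i s where c: "c = (to_nat (S :: pda_state), i, s)" by (cases c) auto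
    show ?thesis using that(1) unfolding c
      by (cases S) (auto simp: \<phi>_def elim!: pda_step.cases split: if_splits)
  qed
  have "k + \<phi> c \<le> C + 2 \<and> fst c \<in> range (to_nat :: pda_state \<Rightarrow> nat)"
    if "(pda_step ?M x ^^ k) (pda_initial ?M) c" for k c
    using that
  proof (induction k arbitrary: c)
    case 0
    then show ?case by (auto simp: \<phi>_def pda_initial_def)
  next
    case (Suc k)
    then obtain c' where "(pda_step ?M x ^^ k) (pda_initial ?M) c'" "pda_step ?M x c' c"
      by (auto elim: relpowp_Suc_E)
    with Suc.IH[of c'] dec[of c' c] show ?case by auto
  qed
  then show ?thesis unfolding all_paths_within_def by fastforce
qed

end


section \<open>Closure under complement\<close>

lemma cosys_card_mono: "N \<le> N' \<Longrightarrow> cosys_card N \<le> cosys_card (N' :: nat)"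
  unfolding cosys_card_def by (intro add_mono mult_mono order_refl) auto

lemma cosys_time_mono: "N \<le> N' \<Longrightarrow> cosys_time N T \<le> cosys_time N' (T :: nat)"
  unfolding cosys_time_def all_time_def find_time_def by (intro add_mono mult_mono order_refl) auto

lemma pda_items_mono: "s \<le> s' \<Longrightarrow> pda_items s B \<le> pda_items s' (B :: nat)"
  unfolding pda_items_def by (intro add_mono mult_mono order_refl) auto

text \<open>The exponent 4 is the stack height from \<open>cosys_run_height\<close>.\<close>

definition nfa_bound :: "'n::comm_semiring_1 \<Rightarrow> 'n \<Rightarrow> 'n" where
  "nfa_bound s B = (cosys_card (s * (B + 1 + 1)) + 1) ^ 4 * (B + 1 + 1)"

definition pda_bound :: "'n::comm_semiring_1 \<Rightarrow> 'n \<Rightarrow> 'n \<Rightarrow> 'n" where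
  "pda_bound N B C = ((B + 1 + 1) * (C + 1) + 1 + 1) * ((N + 1) * (N + 1) + (N + 1) + 1)"

text \<open>\<open>T + T + 1 + 1\<close> counts the allowances from 0 to
  \<open>2 * T + 1\<close>.\<close>

definition budget_items :: "'n::comm_semiring_1 \<Rightarrow> 'n \<Rightarrow> 'n \<Rightarrow> 'n" where
  "budget_items s B T = pda_items s B * (T + T + 1 + 1)"

definition clock_bound :: "'n::comm_semiring_1 \<Rightarrow> 'n \<Rightarrow> 'n \<Rightarrow> 'n" where
  "clock_bound s B T = cosys_time (budget_items s B T) (T + T + 1) * (B + 1 + 1)"

lemma nfa_bound_mono: "s \<le> s' \<Longrightarrow> nfa_bound s B \<le> nfa_bound s' (B :: nat)"
  unfolding nfa_bound_def by (intro mult_mono power_mono add_mono cosys_card_mono order_refl) auto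

lemma pda_bound_mono: "N \<le> N' \<Longrightarrow> pda_bound N B C \<le> pda_bound N' B (C :: nat)"
  unfolding pda_bound_def by (intro add_mono mult_mono order_refl) auto

lemma poly_bounds [simp]:
  fixes n :: nat
  shows "poly (cosys_card p) n = cosys_card (poly p n)"
    "poly (cosys_time p q) n = cosys_time (poly p n) (poly q n)"
    "poly (pda_items p q) n = pda_items (poly p n) (poly q n)"
  by (simp_all add: cosys_card_def cosys_time_def all_time_def find_time_def pda_items_def)

lemma poly_nfa_bound: "poly (nfa_bound p q) n = nfa_bound (poly p n) (poly q n :: nat)"
  by (simp add: nfa_bound_def)

lemma poly_pda_bound: "poly (pda_bound p q r) n = pda_bound (poly p n) (poly q n) (poly r n :: nat)"
  by (simp add: pda_bound_def)

lemma poly_clock_bound: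
  "poly (clock_bound p q r) n = clock_bound (poly p n) (poly q n) (poly r n :: nat)"
  "poly (budget_items p q r) n = budget_items (poly p n) (poly q n) (poly r n)"
  by (simp_all add: clock_bound_def budget_items_def)

lemma nfa_complement:
  fixes M :: "(nat, 'a) nfa2"
  assumes wf: "nfa_wf M" and solves: "nfa_solves M P"
    and B: "\<And>x. x \<in> fst P \<union> snd P \<Longrightarrow> length x \<le> B"
  shows "\<exists>M' :: (nat, 'a) nfa2. nfa_wf M' \<and> nfa_size M' \<le> nfa_bound (nfa_size M) B \<and>
    nfa_solves M' (snd P, fst P)"
proof -
  let ?D = "nfa_sys B M"
  have D: "ds_wf (Suc B) ?D" by (rule wf_nfa_sys[OF wf])
  obtain D' where D': "ds_items D' = {..<card (ds_items (cosys ?D))}" "ds_wf (Suc B) D'"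
    "\<And>x h k. run D' x h k [ds_root D'] \<longleftrightarrow> run (cosys ?D) x h k [ds_root (cosys ?D)]"
    using rename_dsys[OF wf_cosys[OF D]] by metis
  let ?M = "nfa_of 4 (Suc B) D'"
  have "some_path_accepts (nfa_step ?M x) (nfa_accepting ?M) (nfa_initial ?M) \<longleftrightarrow>
      \<not> some_path_accepts (nfa_step M x) (nfa_accepting M) (nfa_initial M)" (is "?l \<longleftrightarrow> _")
    if "x \<in> fst P \<union> snd P" for x
  proof -
    have "?l \<longleftrightarrow> der (cosys ?D) x (ds_root (cosys ?D))"
    proof
      assume ?l
      then show "der (cosys ?D) x (ds_root (cosys ?D))"
        using nfa_of_accepts(1)[OF D'(2), of 4 x] D'(3) by (simp add: der_def)
    next
      assume "der (cosys ?D) x (ds_root (cosys ?D))"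
      from cosys_run_height[OF nfa_sys_linear this] obtain k where "run D' x 4 k [ds_root D']"
        unfolding D'(3) ..
      then show ?l by (intro nfa_of_accepts(2)[OF D'(2)]) auto
    qed
    then show ?thesis unfolding der_cosys[OF D] der_nfa_sys[OF wf B[OF that]] .
  qed
  then have "nfa_solves ?M (snd P, fst P)"
    using solves by (auto simp: nfa_solves_def some_path_accepts_iff)
  moreover have "nfa_size ?M \<le> nfa_bound (nfa_size M) B"
  proof -
    have "card (ds_items ?D) = nfa_size M * (B + 1 + 1)"
      by (simp add: nfa_sys_def nfa_size_def card_cartesian_product)
    then have "card (ds_items D') \<le> cosys_card (nfa_size M * (B + 1 + 1))"
      using card_cosys[OF D] D'(1) by simp
    then have "(card (ds_items D') + 1) ^ 4 * (Suc B + 1) \<le> nfa_bound (nfa_size M) B"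
      unfolding nfa_bound_def by (intro mult_mono power_mono add_mono) auto
    then show ?thesis using nfa_size_of[OF D'(2), of 4] by linarith
  qed
  moreover have "nfa_wf ?M" by (rule wf_nfa_of[OF D'(2)]) simp
  ultimately show ?thesis by blast
qed

text \<open>The search may take exponentially long, so the clock is idle:
  \<open>\<delta> = 0\<close> and \<open>C = 0\<close> leave a single clock value.\<close>

lemma pda_complement:
  fixes M :: "(nat, nat, 'a::finite) npda2"
  assumes wf: "pda_wf M" and solves: "pda_solves M P"
    and B: "\<And>x. x \<in> fst P \<union> snd P \<Longrightarrow> length x \<le> B"
    and s: "pda_size M \<le> s"
  shows "\<exists>M' :: (nat, nat, 'a) npda2. pda_wf M' \<and>
    pda_size M' \<le> pda_bound (cosys_card (pda_items s B)) B 0 \<and> pda_solves M' (snd P, fst P)"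
proof -
  let ?D = "pda_sys B M"
  have D: "ds_wf (Suc B) ?D" by (rule wf_pda_sys[OF wf])
  define N where "N = card (ds_items (cosys ?D))"
  obtain D' where D': "ds_items D' = {..<N}" "ds_wf (Suc B) D'"
    "\<And>x h k. run D' x h k [ds_root D'] \<longleftrightarrow> run (cosys ?D) x h k [ds_root (cosys ?D)]"
    using rename_dsys[OF wf_cosys[OF D]] unfolding N_def by metis
  let ?M = "pda_of 0 0 (Suc B) N D'"
  have "some_path_accepts (pda_step ?M x) (pda_accepting ?M) (pda_initial ?M) \<longleftrightarrow>
      \<not> some_path_accepts (pda_step M x) (pda_accepting M) (pda_initial M)" (is "?l \<longleftrightarrow> \<not> ?r")
    if x: "x \<in> fst P \<union> snd P" for x
  proof -
    have "?l \<longleftrightarrow> der D' x (ds_root D')"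
      using pda_of_accepts(1)[OF D'(2,1)] pda_of_accepts(2)[OF D'(2,1), where \<delta> = 0 and C = 0]
      by (auto simp: der_def)
    moreover have "?r \<longleftrightarrow> der ?D x (ds_root ?D)"
    proof
      assume ?r
      then obtain c where "(pda_step M x)\<^sup>*\<^sup>* (pda_initial M) c" "pda_accepting M c"
        unfolding pda_some_path_accepts_iff by blast
      then show "der ?D x (ds_root ?D)"
        using run_pda_sysI[OF wf B[OF x]] unfolding der_def by (metis rtranclp_imp_relpowp)
    qed (rule der_pda_sysD[OF wf B[OF x]])
    ultimately show ?thesis using der_cosys[OF D, of x] D'(3) by (simp add: der_def)
  qed
  then have "pda_solves ?M (snd P, fst P)"
    using solves by (auto simp: pda_solves_def some_path_accepts_iff)
  moreover have "N \<le> cosys_card (pda_items s B)"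
    using card_cosys[OF D] cosys_card_mono[OF order.trans[OF card_pda_sys[OF wf] pda_items_mono[OF s]]]
    unfolding N_def by (rule order.trans)
  then have "pda_bound N B 0 \<le> pda_bound (cosys_card (pda_items s B)) B 0" by (rule pda_bound_mono)
  then have "pda_size ?M \<le> pda_bound (cosys_card (pda_items s B)) B 0"
    using pda_size_of[OF D'(2,1), of 0 0] by (simp add: pda_bound_def)
  ultimately show ?thesis using wf_pda_of[OF D'(2,1), of 0 0] by blast
qed

text \<open>A path of at most \<open>T\<close> steps yields a derivation with at most
  \<open>2 * T + 1\<close> rules, which fixes the budget. The clock allows each rule of the counting
  derivation \<open>Suc B + 1\<close> steps.\<close>

lemma pda_complement_within:
  fixes M :: "(nat, nat, 'a::finite) npda2"
  assumes wf: "pda_wf M" and solves: "pda_solves_within M P t"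
    and B: "\<And>x. x \<in> fst P \<union> snd P \<Longrightarrow> length x \<le> B"
    and T: "\<And>x. x \<in> fst P \<union> snd P \<Longrightarrow> t (length x) \<le> T"
    and s: "pda_size M \<le> s"
  shows "\<exists>M' :: (nat, nat, 'a) npda2. pda_wf M' \<and>
    pda_size M' \<le> pda_bound (cosys_card (budget_items s B T)) B (clock_bound s B T) \<and>
    pda_solves_within M' (snd P, fst P) (\<lambda>_. clock_bound s B T + 2)"
proof -
  let ?S = "pda_sys B M"
  let ?D = "budget (T + T + 1) ?S"
  let ?C = "clock_bound s B T"
  have S: "ds_wf (Suc B) ?S" by (rule wf_pda_sys[OF wf])
  have D: "ds_wf (Suc B) ?D" by (rule wf_budget[OF S])
  define N where "N = card (ds_items (cosys ?D))"
  obtain D' where D': "ds_items D' = {..<N}" "ds_wf (Suc B) D'"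
    "\<And>x h k. run D' x h k [ds_root D'] \<longleftrightarrow> run (cosys ?D) x h k [ds_root (cosys ?D)]"
    using rename_dsys[OF wf_cosys[OF D]] unfolding N_def by metis
  let ?M = "pda_of 1 ?C (Suc B) N D'"
  have items: "card (ds_items ?D) \<le> budget_items s B T"
    using order.trans[OF card_pda_sys[OF wf] pda_items_mono[OF s]]
    by (simp only: budget_simps card_cartesian_product budget_items_def card_atMost Suc_eq_plus1 mult_le_mono1)
  have clock: "1 * (cosys_time (card (ds_items ?D)) (T + T + 1) * (Suc B + 1)) \<le> ?C"
    unfolding clock_bound_def using cosys_time_mono[OF items] by (simp only: mult_le_mono1 nat_mult_1 Suc_eq_plus1)
  have "some_path_accepts (pda_step ?M x) (pda_accepting ?M) (pda_initial ?M) \<longleftrightarrow>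
      \<not> some_path_accepts (pda_step M x) (pda_accepting M) (pda_initial M)" (is "?l \<longleftrightarrow> \<not> ?r")
    if x: "x \<in> fst P \<union> snd P" for x
  proof -
    have "?l \<longleftrightarrow> der (cosys ?D) x (ds_root (cosys ?D))"
    proof
      assume ?l
      then show "der (cosys ?D) x (ds_root (cosys ?D))"
        using pda_of_accepts(1)[OF D'(2,1)] D'(3) by (simp add: der_def)
    next
      assume d: "der (cosys ?D) x (ds_root (cosys ?D))"
      have "\<exists>h. run (cosys ?D) x h (cosys_time (card (ds_items ?D)) (T + T + 1)) [ds_root (cosys ?D)]"
        \<comment> \<open>The allowance \<open>snd\<close> is the required weight; it is at most
          \<open>T + T + 1\<close>.\<close>
        by (rule cosys_run_weight[where w = snd, OF D budget_weight _ d]) auto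
      then obtain h where "run D' x h (cosys_time (card (ds_items ?D)) (T + T + 1)) [ds_root D']"
        unfolding D'(3) ..
      then show ?l by (rule pda_of_accepts(2)[OF D'(2,1) _ clock])
    qed
    moreover have "?r \<longleftrightarrow> der ?D x (ds_root ?D)"
    proof
      assume ?r
      then obtain c k where c: "(pda_step M x ^^ k) (pda_initial M) c" "pda_accepting M c"
        unfolding pda_some_path_accepts_iff by (meson rtranclp_imp_relpowp)
      have "k \<le> t (length x)"
        using solves x c(1) unfolding pda_solves_within_def all_paths_within_def by blast
      then have "2 * k + 1 \<le> T + T + 1" using T[OF x] by simp
      then show "der ?D x (ds_root ?D)"
        using run_pda_sysI[OF wf B[OF x] c] der_budgetI by blast
    next
      assume "der ?D x (ds_root ?D)"
      then show ?r by (rule der_pda_sysD[OF wf B[OF x] der_budgetD])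
    qed
    ultimately show ?thesis using der_cosys[OF D, of x] by simp
  qed
  then have "pda_solves ?M (snd P, fst P)"
    using solves by (auto simp: pda_solves_within_def pda_solves_def some_path_accepts_iff)
  then have "pda_solves_within ?M (snd P, fst P) (\<lambda>_. ?C + 2)"
    using pda_of_time[OF D'(2,1)] by (simp add: pda_solves_within_def)
  moreover have "N \<le> cosys_card (budget_items s B T)"
    using card_cosys[OF D] cosys_card_mono[OF items] unfolding N_def by (rule order.trans)
  then have "pda_bound N B ?C \<le> pda_bound (cosys_card (budget_items s B T)) B ?C" by (rule pda_bound_mono)
  then have "pda_size ?M \<le> pda_bound (cosys_card (budget_items s B T)) B ?C"
    using pda_size_of[OF D'(2,1), of 1 ?C] by (simp add: pda_bound_def)
  ultimately show ?thesis using wf_pda_of[OF D'(2,1), of 1 ?C] by blast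
qed

section \<open>From single machines to families\<close>

lemma poly2_mono: "m \<le> m' \<Longrightarrow> poly2 t n m \<le> poly2 t n m'"
  unfolding poly2_def
  by (induction t) (auto intro!: add_mono mult_mono)

lemma poly2_poly: "poly2 t n (poly q n) = poly (poly t q) n"
  unfolding poly2_def by (induction t) auto

abbreviation co_family :: "'a family \<Rightarrow> 'a family" where
  "co_family L \<equiv> \<lambda>n. (snd (L n), fst (L n))"

lemma two_N_co_family:
  assumes "L \<in> two_N" "polynomial_ceiling L"
  shows "co_family L \<in> two_N"
proof -
  obtain M :: "nat \<Rightarrow> (nat, 'a) nfa2" and p :: "nat poly" where
    M: "\<And>n. nfa_wf (M n)" "\<And>n. nfa_size (M n) \<le> poly p n" "\<And>n. nfa_solves (M n) (L n)"
    and pr: "\<And>n. promise_problem (L n)"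
    using assms(1) unfolding two_N_def by auto
  obtain q :: "nat poly" where q: "\<And>n x. x \<in> fst (L n) \<union> snd (L n) \<Longrightarrow> length x \<le> poly q n"
    using assms(2) unfolding polynomial_ceiling_def by auto
  have "\<exists>M' :: (nat, 'a) nfa2. nfa_wf M' \<and> nfa_size M' \<le> poly (nfa_bound p q) n \<and>
      nfa_solves M' (co_family L n)" for n
    using nfa_complement[OF M(1,3) q] nfa_bound_mono[OF M(2), of n "poly q n"] order.trans
    unfolding poly_nfa_bound by blast
  then obtain M' :: "nat \<Rightarrow> (nat, 'a) nfa2" where "\<forall>n. nfa_wf (M' n) \<and>
      nfa_size (M' n) \<le> poly (nfa_bound p q) n \<and> nfa_solves (M' n) (co_family L n)" by metis
  then show ?thesis using pr unfolding two_N_def by (auto simp: promise_problem_def Int_commute)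
qed

lemma two_NPD_co_family:
  fixes L :: "'a::finite family"
  assumes "L \<in> two_NPD" "polynomial_ceiling L"
  shows "co_family L \<in> two_NPD"
proof -
  obtain M :: "nat \<Rightarrow> (nat, nat, 'a) npda2" and p :: "nat poly" where
    M: "\<And>n. pda_wf (M n)" "\<And>n. pda_size (M n) \<le> poly p n" "\<And>n. pda_solves (M n) (L n)"
    and pr: "\<And>n. promise_problem (L n)"
    using assms(1) unfolding two_NPD_def by auto
  obtain q :: "nat poly" where q: "\<And>n x. x \<in> fst (L n) \<union> snd (L n) \<Longrightarrow> length x \<le> poly q n"
    using assms(2) unfolding polynomial_ceiling_def by auto
  have "\<exists>M' :: (nat, nat, 'a) npda2. pda_wf M' \<and>
      pda_size M' \<le> poly (pda_bound (cosys_card (pda_items p q)) q 0) n \<and> pda_solves M' (co_family L n)" for n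
    using pda_complement[OF M(1,3) q M(2), of n] unfolding poly_pda_bound by simp
  then obtain M' :: "nat \<Rightarrow> (nat, nat, 'a) npda2" where "\<forall>n. pda_wf (M' n) \<and>
      pda_size (M' n) \<le> poly (pda_bound (cosys_card (pda_items p q)) q 0) n \<and>
      pda_solves (M' n) (co_family L n)" by metis
  then show ?thesis using pr unfolding two_NPD_def by (auto simp: promise_problem_def Int_commute)
qed

text \<open>The ceiling \<open>q\<close> turns the bound into a polynomial in \<open>n\<close>
  alone: coefficients are natural numbers, so the value at the input length is at most the value at
  \<open>q(n)\<close>. The new time bound is constant in the input length.\<close>

lemma two_NPD_ptime_co_family:
  fixes L :: "'a::finite family"
  assumes "L \<in> two_NPD_ptime" "polynomial_ceiling L"
  shows "co_family L \<in> two_NPD_ptime"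
proof -
  obtain M :: "nat \<Rightarrow> (nat, nat, 'a) npda2" and p :: "nat poly" and t :: "nat poly poly" where
    all: "\<forall>n. pda_wf (M n) \<and> pda_size (M n) \<le> poly p n \<and>
      pda_solves_within (M n) (L n) (poly2 t n)" and pr: "\<forall>n. promise_problem (L n)"
    using assms(1) unfolding two_NPD_ptime_def by blast
  then have M: "\<And>n. pda_wf (M n)" "\<And>n. pda_size (M n) \<le> poly p n"
    "\<And>n. pda_solves_within (M n) (L n) (poly2 t n)" by blast+
  obtain q :: "nat poly" where q: "\<And>n x. x \<in> fst (L n) \<union> snd (L n) \<Longrightarrow> length x \<le> poly q n"
    using assms(2) unfolding polynomial_ceiling_def by auto
  let ?T = "poly t q"
  let ?s = "pda_bound (cosys_card (budget_items p q ?T)) q (clock_bound p q ?T)"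
  let ?t = "[:clock_bound p q ?T + 2:]"
  have T: "poly2 t n (length x) \<le> poly ?T n" if "x \<in> fst (L n) \<union> snd (L n)" for n x
    using poly2_mono[OF q[OF that], of t n] by (simp add: poly2_poly)
  have t: "poly2 ?t n = (\<lambda>_. clock_bound (poly p n) (poly q n) (poly ?T n) + 2)" for n
    by (rule ext) (simp add: poly2_def poly_clock_bound)
  have "\<exists>M' :: (nat, nat, 'a) npda2. pda_wf M' \<and> pda_size M' \<le> poly ?s n \<and>
      pda_solves_within M' (co_family L n) (poly2 ?t n)" for n
    using pda_complement_within[OF M(1,3) q[where n = n] T[where n = n] M(2)]
    unfolding t by (simp add: poly_pda_bound poly_clock_bound)
  then obtain M' :: "nat \<Rightarrow> (nat, nat, 'a) npda2" where "\<forall>n. pda_wf (M' n) \<and>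
      pda_size (M' n) \<le> poly ?s n \<and> pda_solves_within (M' n) (co_family L n) (poly2 ?t n)" by metis
  then show ?thesis using pr unfolding two_NPD_ptime_def
    by (auto simp: promise_problem_def Int_commute simp del: poly_bounds)
qed

text \<open>Swapping is an involution that respects the ceiling, so closure under it gives both
  inclusions.\<close>

lemma over_poly_co:
  assumes "\<And>L. L \<in> C \<Longrightarrow> polynomial_ceiling L \<Longrightarrow> co_family L \<in> C"
  shows "over_poly C = over_poly (co C)"
proof -
  have ceiling: "polynomial_ceiling (co_family L) \<longleftrightarrow> polynomial_ceiling L" for L :: "'a family"
    by (simp add: polynomial_ceiling_def Un_commute)
  have "L \<in> C \<longleftrightarrow> L \<in> co C" if "polynomial_ceiling L" for L
  proof
    assume "L \<in> C"
    then have "co_family L \<in> C" using assms that by blast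
    then show "L \<in> co C" unfolding co_def by (intro CollectI exI[of _ "co_family L"]) simp
  next
    assume "L \<in> co C"
    then obtain L' where "L = co_family L'" "L' \<in> C" unfolding co_def by blast
    then show "L \<in> C" using assms that ceiling by blast
  qed
  then show ?thesis unfolding over_poly_def by blast
qed

theorem theorem5p4:
  "over_poly (two_N :: 'a::finite family set) = over_poly (co two_N) \<and>
   over_poly (two_NPD :: 'a family set) = over_poly (co two_NPD) \<and>
   over_poly (two_NPD_ptime :: 'a family set) = over_poly (co two_NPD_ptime)"
  by (intro conjI over_poly_co two_N_co_family two_NPD_co_family two_NPD_ptime_co_family)

end
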